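(* Let $\lambda >0$ and let $X(\lambda)$ be a Poisson random variable with mean $\lambda$. Fix $A>0$. \begin{enumerate} \item For integers $1\le k \le A\lambda^{1/3}$, \[ \mathbb{E}\bigg(\frac{X(\lambda)-\lambda}{\sqrt{\lambda}} \bigg)^k = \bigg( \mu_k + \frac{k(k-1)\mu_{k-1}}{6\sqrt{\lambda}}\bigg)\bigg(1+O_A\Big( \frac{k^3}{\lambda}\Big)\bigg).\] \item If $k=k(\lambda)\asymp \lambda^{1/3}$ and $\lambda\to \infty$, then \[ M_k^{-1} \mathbb{E}\bigg(\frac{X(\lambda)-\lambda}{\sqrt{\lambda}} \bigg)^k \sim \frac{1}{2}\exp\bigg( \frac{k^{3/2}}{6\lambda^{1/2}}\bigg) \bigg(1 +(-1)^k \exp\Big( - \frac{k^{3/2}}{3\lambda^{1/2}}\Big)\bigg) \asymp 1.\] \item If $k/\lambda^{1/3} \to \infty$ while $k=o(\lambda^{1/2})$, then letting $r=\sqrt{k/\lambda}$, \[ M_k^{-1} \mathbb{E}\bigg(\frac{X(\lambda)-\lambda}{\sqrt{\lambda}} \bigg)^k \sim \frac{1}{2} e^{\lambda(e^{r}-(1+r+r^2/2))}\to \infty.\] \end{enumerate}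
   Context: $\mu_k=\frac{k!}{2^{k/2}(k/2)!}$ for even $k$ and $\mu_k=0$ for odd $k$; $M_k=\frac{k!}{2^{k/2}\Gamma(k/2+1)}$. The implied constant in $O_A$ depends only on $A$. $f\asymp g$ means $f\ll g\ll f$; $f\sim g$ means $f/g\to 1$. *)

theory Defs
  imports "HOL-Probability.Probability" "HOL-Library.Landau_Symbols"
begin

definition poisson_std_moment :: "real \<Rightarrow> nat \<Rightarrow> real" where
  "poisson_std_moment l k =
     measure_pmf.expectation (poisson_pmf l) (\<lambda>n. ((real n - l) / sqrt l) ^ k)"

definition gauss_moment :: "nat \<Rightarrow> real" where
  "gauss_moment k = (if even k then fact k / (2 ^ (k div 2) * fact (k div 2)) else 0)"

text \<open>The Gamma-function interpolation of \<^const>\<open>gauss_moment\<close> from even to arbitrary order;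
  unlike \<^const>\<open>gauss_moment\<close>, it is positive at odd orders.\<close>

definition gauss_moment_Gamma :: "nat \<Rightarrow> real" where
  "gauss_moment_Gamma k = fact k / (2 powr (real k / 2) * Gamma (real k / 2 + 1))"

end

theory Submission
  imports Defs "HOL-Complex_Analysis.Complex_Analysis" "HOL-Real_Asymp.Real_Asymp"
begin

text \<open>
  The central moments of the Poisson distribution are \<open>k!\<close> times the coefficients of
  \<open>exp (l (e\<^sup>z - 1 - z)) = exp (l z\<^sup>2 / 2) B(z)\<close> with \<open>B(z) = exp (l (e\<^sup>z - 1 - z - z\<^sup>2 / 2))\<close>.
  The coefficients \<open>b\<^sub>m\<close> of \<open>B\<close> are nonnegative, so dividing by \<open>M\<^sub>k\<close> writes the normalised moment as
  a sum of \<open>b\<^sub>m r\<^sup>m w\<^sub>m\<close> over \<open>m \<le> k\<close> of the parity of \<open>k\<close>, where \<open>r = sqrt (k / l)\<close> and the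
  weights satisfy \<open>1 - m\<^sup>2 / k \<le> w\<^sub>m \<le> 1\<close> whenever \<open>b\<^sub>m \<noteq> 0\<close>. Replacing all weights by \<open>1\<close> gives
  \<open>(B(r) + (-1)\<^sup>k B(-r)) / 2\<close> as an upper bound, and the loss is at most
  \<open>3 r\<^sup>2 B''(r) / (2 k)\<close>, which is \<open>o(B(r))\<close> for \<open>k = o(l\<^sup>1\<^sup>/\<^sup>2)\<close>. For \<open>k = O(l\<^sup>1\<^sup>/\<^sup>3)\<close> the main term
  is exactly the summand \<open>m = 0\<close> (\<open>k\<close> even) or \<open>m = 3\<close> (\<open>k\<close> odd), and positivity together with
  the upper bound controls the rest.
\<close>

unbundle no vec_syntax
unbundle fps_syntax

section \<open>Central moments of the Poisson distribution\<close>

text \<open>Since \<open>y ^ k / k!\<close> is a single term of the series of \<open>exp y\<close>,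
  the factor \<open>\<bar>n - l\<bar> ^ k\<close> is at most
  \<open>k! * exp \<bar>l\<bar> * e ^ n\<close>; this leaves the exponential series at
  \<open>\<bar>l\<bar> * e\<close>.\<close>

lemma poisson_summable_power:
  fixes l :: real
  shows "summable (\<lambda>n. l ^ n / fact n * \<bar>real n - l\<bar> ^ k)"
proof (rule summable_comparison_test)
  have "summable (\<lambda>n. (\<bar>l\<bar> * exp 1) ^ n /\<^sub>R fact n)"
    by (rule summable_exp_generic)
  then have "summable (\<lambda>n. fact k * exp \<bar>l\<bar> * ((\<bar>l\<bar> * exp 1) ^ n /\<^sub>R fact n))"
    by (rule summable_mult)
  then show "summable (\<lambda>n. fact k * exp \<bar>l\<bar> * (\<bar>l\<bar> ^ n * exp 1 ^ n / fact n))"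
    by (simp add: power_mult_distrib divide_inverse mult_ac)
  show "\<exists>N. \<forall>n\<ge>N. norm (l ^ n / fact n * \<bar>real n - l\<bar> ^ k)
      \<le> fact k * exp \<bar>l\<bar> * (\<bar>l\<bar> ^ n * exp 1 ^ n / fact n)"
  proof (intro exI allI impI)
    fix n :: nat
    have "\<bar>real n - l\<bar> ^ k / fact k \<le> exp \<bar>real n - l\<bar>"
    proof -
      have "(\<lambda>i. \<bar>real n - l\<bar> ^ i /\<^sub>R fact i) sums exp \<bar>real n - l\<bar>"
        by (rule exp_converges)
      then have "(\<Sum>i\<in>{k}. \<bar>real n - l\<bar> ^ i /\<^sub>R fact i) \<le> exp \<bar>real n - l\<bar>"
        using sum_le_suminf[of "\<lambda>i. \<bar>real n - l\<bar> ^ i /\<^sub>R fact i" "{k}"] by (simp add: sums_iff)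
      then show ?thesis by (simp add: divide_inverse mult_ac)
    qed
    also have "\<dots> \<le> exp (\<bar>l\<bar> + real n)"
      by simp
    also have "\<dots> = exp \<bar>l\<bar> * exp 1 ^ n"
      by (simp add: exp_add flip: exp_of_nat_mult)
    finally have "\<bar>real n - l\<bar> ^ k \<le> fact k * (exp \<bar>l\<bar> * exp 1 ^ n)"
      by (simp add: field_simps)
    then have "\<bar>l\<bar> ^ n / fact n * \<bar>real n - l\<bar> ^ k \<le> \<bar>l\<bar> ^ n / fact n * (fact k * (exp \<bar>l\<bar> * exp 1 ^ n))"
      by (intro mult_left_mono) auto
    then show "norm (l ^ n / fact n * \<bar>real n - l\<bar> ^ k)
      \<le> fact k * exp \<bar>l\<bar> * (\<bar>l\<bar> ^ n * exp 1 ^ n / fact n)"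
      by (simp add: abs_mult power_abs mult_ac)
  qed
qed

lemma poisson_expectation_sums:
  fixes l :: real and f :: "nat \<Rightarrow> real"
  assumes "0 < l" "summable (\<lambda>n. l ^ n / fact n * \<bar>f n\<bar>)"
  shows "(\<lambda>n. l ^ n / fact n * exp (-l) * f n) sums measure_pmf.expectation (poisson_pmf l) f"
proof -
  have s: "summable (\<lambda>n. \<bar>l ^ n / fact n * exp (-l) * f n\<bar>)"
    using summable_mult[OF assms(2), of "exp (-l)"] assms(1) by (simp add: abs_mult mult_ac)
  have "measure_pmf.expectation (poisson_pmf l) f
      = integral\<^sup>L (count_space UNIV) (\<lambda>n. pmf (poisson_pmf l) n *\<^sub>R f n)"
    unfolding measure_pmf_eq_density by (subst integral_density) auto
  moreover have "integrable (count_space UNIV) (\<lambda>n. pmf (poisson_pmf l) n *\<^sub>R f n)"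
    using s assms(1) by (simp add: integrable_count_space_nat_iff abs_mult)
  ultimately show ?thesis
    using sums_integral_count_space_nat[of "\<lambda>n. pmf (poisson_pmf l) n *\<^sub>R f n"] assms(1) by simp
qed

section \<open>The power series of \<open>B\<close>\<close>

text \<open>The coefficients \<open>b_m\<close> of \<open>B\<close>. The field is generic because
  convergence is obtained over the complex numbers, while nonnegativity and the moments live over
  the reals.\<close>

definition excess_fps :: "'a::field_char_0 \<Rightarrow> 'a fps" where
  "excess_fps l = fps_exp l oo (fps_exp 1 - 1 - fps_X - fps_const (1/2) * fps_X ^ 2)"

lemma fps_deriv_excess_fps:
  "fps_deriv (excess_fps l) = fps_const l * (fps_exp 1 - 1 - fps_X) * excess_fps l"
proof -
  have "fps_deriv (fps_exp 1 - 1 - fps_X - fps_const (1/2) * fps_X ^ 2 :: 'a fps) = fps_exp 1 - 1 - fps_X"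
    by (simp add: fps_deriv_power fps_eq_iff)
  then show ?thesis
    unfolding excess_fps_def
    by (subst fps_compose_deriv) (simp_all add: fps_compose_mult_distrib mult_ac)
qed

lemma excess_fps_nth_0 [simp]: "excess_fps l $ 0 = 1"
  by (simp add: excess_fps_def)

text \<open>Compares coefficients in \<open>B' = l (e^z - 1 - z) B\<close>; the sum starts at 2
  because \<open>e^z - 1 - z\<close> has no terms below \<open>z^2\<close>. Nonnegativity, the first
  values, and the agreement of the real and complex coefficients are all read off from this
  recursion.\<close>

lemma excess_fps_nth_Suc:
  "excess_fps l $ Suc m
    = l / of_nat (Suc m) * (\<Sum>i\<in>{2..m}. excess_fps l $ (m - i) / fact i)"
proof -
  have "of_nat (Suc m) * excess_fps l $ Suc m = fps_deriv (excess_fps l) $ m"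
    by (simp add: fps_deriv_nth)
  also have "\<dots> = l * (\<Sum>i=0..m. (fps_exp 1 - 1 - fps_X :: 'a fps) $ i * excess_fps l $ (m - i))"
    unfolding fps_deriv_excess_fps mult.assoc fps_mult_left_const_nth by (simp add: fps_mult_nth)
  also have "(\<Sum>i=0..m. (fps_exp 1 - 1 - fps_X :: 'a fps) $ i * excess_fps l $ (m - i))
      = (\<Sum>i\<in>{2..m}. excess_fps l $ (m - i) / fact i)"
    by (rule sum.mono_neutral_cong_right) (auto simp: not_le less_2_cases_iff)
  finally show ?thesis
    by (simp add: field_simps del: of_nat_Suc)
qed

lemma excess_fps_nth_1 [simp]: "excess_fps l $ Suc 0 = 0"
  by (subst excess_fps_nth_Suc) simp

lemma excess_fps_nth_2 [simp]: "excess_fps l $ 2 = 0"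
  using excess_fps_nth_Suc[of l 1] by (simp add: numeral_2_eq_2)

lemma excess_fps_nth_3: "excess_fps l $ 3 = l / 6"
  using excess_fps_nth_Suc[of l 2] by (simp add: numeral_3_eq_3 numeral_2_eq_2)

lemma excess_fps_nonneg: "0 \<le> l \<Longrightarrow> 0 \<le> excess_fps (l::real) $ m"
proof (induction m rule: less_induct)
  case (less m)
  show ?case
  proof (cases m)
    case (Suc n)
    then show ?thesis using less by (auto simp: excess_fps_nth_Suc intro!: mult_nonneg_nonneg sum_nonneg divide_nonneg_nonneg)
  qed simp
qed

lemma excess_fps_of_real: "excess_fps (of_real l) $ m = complex_of_real (excess_fps l $ m)"
proof (induction m rule: less_induct)
  case (less m)
  show ?case
  proof (cases m)
    case (Suc n)
    then show ?thesis using less by (simp add: excess_fps_nth_Suc del: of_nat_Suc)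
  qed simp
qed

definition excess_exp :: "real \<Rightarrow> real \<Rightarrow> real" where
  "excess_exp l x = exp (l * (exp x - (1 + x + x\<^sup>2 / 2)))"

lemma excess_exp_pos [simp]: "0 < excess_exp l x"
  by (simp add: excess_exp_def)

text \<open>Over the complex numbers \<open>B\<close> is entire, so its expansion converges
  everywhere (hence the radius \<open>\<infinity>\<close>); the real statement is its restriction to
  the real axis.\<close>

lemma excess_fps_sums:
  fixes l x :: real
  shows "(\<lambda>m. excess_fps l $ m * x ^ m) sums excess_exp l x"
proof -
  let ?g = "\<lambda>z::complex. exp z - 1 - z - z\<^sup>2 / 2"
  have "?g has_fps_expansion fps_exp 1 - 1 - fps_X - fps_const (1/2) * fps_X ^ 2"
    using has_fps_expansion_diff[OF has_fps_expansion_diff[OF has_fps_expansion_diff[OF has_fps_expansion_exp1 has_fps_expansion_1] has_fps_expansion_fps_X]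
      has_fps_expansion_cmult_left[OF has_fps_expansion_fps_X_power[of 2], of "1/2"]] by simp
  then have "((\<lambda>z. exp (of_real l * z)) \<circ> ?g) has_fps_expansion excess_fps (complex_of_real l)"
    unfolding excess_fps_def by (rule has_fps_expansion_compose[OF has_fps_expansion_exp]) simp
  then have "(\<lambda>m. excess_fps (complex_of_real l) $ m * of_real x ^ m)
      sums ((\<lambda>z. exp (of_real l * z)) \<circ> ?g) (of_real x)"
    by (rule has_fps_expansion_imp_sums_complex[where r = \<infinity>]) (auto intro!: holomorphic_intros simp: o_def)
  moreover have "((\<lambda>z. exp (of_real l * z)) \<circ> ?g) (of_real x)
      = complex_of_real (excess_exp l x)"
  proof -
    have "exp (complex_of_real x) - 1 - of_real x - (of_real x)\<^sup>2 / 2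
        = of_real (exp x - (1 + x + x\<^sup>2 / 2))"
      by (simp flip: exp_of_real)
    then show ?thesis
      by (simp only: o_def excess_exp_def exp_of_real flip: of_real_mult)
  qed
  ultimately have "(\<lambda>m. complex_of_real (excess_fps l $ m * x ^ m))
      sums complex_of_real (excess_exp l x)"
    by (simp add: excess_fps_of_real)
  then show ?thesis
    by (simp only: sums_of_real_iff)
qed

text \<open>The coefficients of \<open>exp (l z\<^sup>2 / 2)\<close>.\<close>

definition gauss_fps :: "real \<Rightarrow> real fps" where
  "gauss_fps l = Abs_fps (\<lambda>n. if even n then (l / 2) ^ (n div 2) / fact (n div 2) else 0)"

text \<open>Together with \<open>fps_deriv_excess_fps\<close>, this gives the product of the two
  series the differential equation \<open>H' = l (e^z - 1) H\<close>.\<close>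

lemma fps_deriv_gauss_fps: "fps_deriv (gauss_fps l) = fps_const l * fps_X * gauss_fps l"
proof (rule fps_ext)
  fix n
  show "fps_deriv (gauss_fps l) $ n = (fps_const l * fps_X * gauss_fps l) $ n"
  proof (cases "\<exists>j. n = 2 * j + 1")
    case True
    then obtain j where j: "n = 2 * j + 1" by blast
    have "(2 + 2 * real j) = 2 * real (Suc j)" by simp
    then show ?thesis
      unfolding mult.assoc fps_mult_left_const_nth j
      by (simp add: gauss_fps_def fps_deriv_nth fps_X_mult_nth divide_simps)
  next
    case False
    then have "even n" by (metis oddE)
    then show ?thesis
      unfolding mult.assoc fps_mult_left_const_nth
      by (auto simp add: gauss_fps_def fps_deriv_nth fps_X_mult_nth)
  qed
qed

text \<open>Stein-Chen identity \<open>E[X f(X)] = l E[f(X + 1)]\<close> for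
  \<open>f(x) = (x - l)^k\<close>, with \<open>(1 + (X - l))^k\<close> expanded by the binomial
  theorem. Subtracting \<open>l E[f(X)]\<close> removes the term \<open>i = 0\<close>.\<close>

lemma poisson_central_moment_Suc:
  fixes l :: real
  assumes "0 < l"
  defines "P \<equiv> \<lambda>k::nat. measure_pmf.expectation (poisson_pmf l) (\<lambda>n. (real n - l) ^ k)"
  shows "P (Suc k) = l * (\<Sum>i=1..k. of_nat (k choose i) * P (k - i))"
proof -
  define p where "p = (\<lambda>n. l ^ n / fact n * exp (-l))"
  have P: "(\<lambda>n. p n * (real n - l) ^ j) sums P j" for j
    unfolding P_def p_def using assms(1) poisson_summable_power[of l j]
    by (intro poisson_expectation_sums) (auto simp: power_abs)
  have p_Suc: "p (Suc n) * real (Suc n) = l * p n" for n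
    by (simp add: p_def field_simps del: of_nat_Suc)
  have "(\<lambda>n. \<Sum>i\<le>k. real (k choose i) * (p n * (real n - l) ^ (k - i))) sums
      (\<Sum>i\<le>k. real (k choose i) * P (k - i))"
    by (intro sums_sum sums_mult P)
  then have "(\<lambda>n. p n * (real (Suc n) - l) ^ k) sums (\<Sum>i\<le>k. real (k choose i) * P (k - i))"
  proof (rule sums_cong[THEN iffD1, rotated])
    fix n
    have "(real (Suc n) - l) ^ k = (1 + (real n - l)) ^ k" by (simp add: algebra_simps)
    also have "\<dots> = (\<Sum>i\<le>k. real (k choose i) * (real n - l) ^ (k - i))"
      by (subst binomial_ring) simp
    finally show "(\<Sum>i\<le>k. real (k choose i) * (p n * (real n - l) ^ (k - i)))
        = p n * (real (Suc n) - l) ^ k"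
      by (simp only: sum_distrib_left mult_ac)
  qed
  then have "(\<lambda>n. l * (p n * (real (Suc n) - l) ^ k)) sums (l * (\<Sum>i\<le>k. real (k choose i) * P (k - i)))"
    by (rule sums_mult)
  then have "(\<lambda>n. p (Suc n) * real (Suc n) * (real (Suc n) - l) ^ k)
      sums (l * (\<Sum>i\<le>k. real (k choose i) * P (k - i)))"
    by (simp only: p_Suc mult.assoc)
  \<comment> \<open>The index shift adds no boundary term, since the summand at 0 contains the
    factor \<open>real 0\<close>.\<close>
  then have "(\<lambda>n. p n * real n * (real n - l) ^ k) sums (l * (\<Sum>i\<le>k. real (k choose i) * P (k - i)))"
    by (subst (asm) sums_Suc_iff) simp
  then have "(\<lambda>n. p n * real n * (real n - l) ^ k - l * (p n * (real n - l) ^ k))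
      sums (l * (\<Sum>i\<le>k. real (k choose i) * P (k - i)) - l * P k)"
    by (intro sums_diff sums_mult P)
  then have "(\<lambda>n. p n * (real n - l) ^ Suc k)
      sums (l * ((\<Sum>i\<le>k. real (k choose i) * P (k - i)) - P k))"
    by (simp add: algebra_simps)
  then have "P (Suc k) = l * ((\<Sum>i\<le>k. real (k choose i) * P (k - i)) - P k)"
    using P sums_unique2 by blast
  also have "(\<Sum>i\<le>k. real (k choose i) * P (k - i)) = P k + (\<Sum>i=1..k. real (k choose i) * P (k - i))"
    by (simp add: atMost_atLeast0 sum.atLeast_Suc_atMost)
  finally show ?thesis by simp
qed

text \<open>Both sides satisfy the same recursion: the left by
  \<open>poisson_central_moment_Suc\<close>, the right by the differential equation of the product
  series.\<close>

lemma poisson_central_moment_eq: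
  fixes l :: real
  assumes "0 < l"
  shows "measure_pmf.expectation (poisson_pmf l) (\<lambda>n. (real n - l) ^ k)
    = fact k * (excess_fps l * gauss_fps l) $ k"
proof -
  let ?P = "\<lambda>k::nat. measure_pmf.expectation (poisson_pmf l) (\<lambda>n. (real n - l) ^ k)"
  define H where "H = excess_fps l * gauss_fps l"
  have dH: "fps_deriv H = fps_const l * ((fps_exp 1 - 1) * H)"
    unfolding H_def by (simp add: fps_deriv_excess_fps fps_deriv_gauss_fps algebra_simps)
  have "?P k = fact k * H $ k"
  proof (induction k rule: less_induct)
    case (less k)
    show ?case
    proof (cases k)
      case 0
      then show ?thesis by (simp add: H_def gauss_fps_def)
    next
      case (Suc n)
      have "of_nat (Suc n) * H $ Suc n = l * (\<Sum>i=0..n. (fps_exp 1 - 1 :: real fps) $ i * H $ (n - i))"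
        using arg_cong[OF dH, of "\<lambda>f. f $ n"] by (simp add: fps_deriv_nth fps_mult_nth[of _ H])
      also have "(\<Sum>i=0..n. (fps_exp 1 - 1 :: real fps) $ i * H $ (n - i)) = (\<Sum>i=1..n. H $ (n - i) / fact i)"
        by (rule sum.mono_neutral_cong_right) auto
      \<comment> \<open>The factor \<open>n!\<close> turns the coefficient recursion into the
        binomial one, because \<open>(n choose i) (n - i)! = n! / i!\<close>.\<close>
      finally have *: "fact n * (of_nat (Suc n) * H $ Suc n) = l * (\<Sum>i=1..n. fact n * (H $ (n - i) / fact i))"
        by (simp only: sum_distrib_left mult_ac)
      have "?P k = l * (\<Sum>i=1..n. of_nat (n choose i) * ?P (n - i))"
        unfolding Suc using assms by (rule poisson_central_moment_Suc)
      also have "(\<Sum>i=1..n. of_nat (n choose i) * ?P (n - i)) = (\<Sum>i=1..n. fact n * (H $ (n - i) / fact i))"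
        using less Suc by (intro sum.cong) (auto simp: binomial_fact)
      finally show ?thesis
        using * Suc by (simp add: mult_ac)
    qed
  qed
  then show ?thesis by (simp add: H_def)
qed

section \<open>Gamma weights\<close>

lemma Gamma_real_neq_0: "0 < x \<Longrightarrow> Gamma (x::real) \<noteq> 0"
  by (metis Gamma_real_pos less_irrefl)

text \<open>Log-convexity of \<open>Gamma\<close> at the midpoint of \<open>y\<close> and
  \<open>y + 1\<close>, followed by the functional equation.\<close>

lemma Gamma_plus_half_bound:
  fixes y :: real
  assumes "0 < y"
  shows "Gamma (y + 1/2) ^ 2 \<le> y * Gamma y ^ 2"
proof -
  have "(ln \<circ> Gamma) ((1 - 1/2) *\<^sub>R y + (1/2) *\<^sub>R (y + 1))
      \<le> (1 - 1/2) * (ln \<circ> Gamma) y + 1/2 * (ln \<circ> Gamma) (y + 1)"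
    using assms by (intro convex_onD[OF log_convex_Gamma_real]) auto
  then have "2 * ln (Gamma (y + 1/2)) \<le> ln (Gamma y) + ln (Gamma (y + 1))"
    by (simp add: algebra_simps add_divide_distrib)
  then have "ln (Gamma (y + 1/2) ^ 2) \<le> ln (Gamma y * Gamma (y + 1))"
    using assms Gamma_real_neq_0[of "y + 1/2"] by (subst ln_mult_pos) (simp_all add: ln_realpow)
  then have "Gamma (y + 1/2) ^ 2 \<le> Gamma y * Gamma (y + 1)"
    by (rule ln_le_cancel_iff[THEN iffD1, rotated 2])
      (use assms in \<open>auto simp: Gamma_real_neq_0\<close>)
  then show ?thesis
    using assms by (subst (asm) Gamma_plus1) (auto simp: power2_eq_square mult_ac)
qed

text \<open>The factor that replaces \<open>1\<close> when \<open>gauss_moment_Gamma k\<close> is taken out of the contribution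
  of the \<open>m\<close>-th coefficient; it vanishes for \<open>m > k\<close> of the parity of \<open>k\<close> because of the zeros
  of \<open>rGamma\<close>.\<close>

definition weight :: "nat \<Rightarrow> nat \<Rightarrow> real" where
  "weight k m = sqrt (2 / k) ^ m * Gamma (k / 2 + 1) * rGamma ((real k - real m) / 2 + 1)"

lemma weight_0 [simp]: "weight k 0 = 1"
proof -
  have "Gamma (real k / 2 + 1) \<noteq> 0"
    by (intro Gamma_real_neq_0 add_nonneg_pos) auto
  then show ?thesis by (simp add: weight_def rGamma_inverse_Gamma)
qed

text \<open>This is the functional equation of \<open>rGamma\<close>. Using \<open>rGamma\<close>
  instead of dividing by \<open>Gamma\<close> keeps it valid beyond \<open>m = k\<close>, where
  \<open>Gamma\<close> may have poles.\<close>

lemma weight_add_2: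
  assumes "1 \<le> k"
  shows "weight k (m + 2) = weight k m * (1 - m / k)"
proof -
  define R where "R = rGamma ((real k - real m) / 2 + 1)"
  have "(real k - real (m + 2)) / 2 + 1 = (real k - real m) / 2"
    by (simp add: diff_divide_distrib add_divide_distrib)
  then have "rGamma ((real k - real (m + 2)) / 2 + 1) = (real k - real m) / 2 * R"
    unfolding R_def by (simp only: rGamma_plus1)
  moreover have "sqrt (2 / k) ^ (m + 2) = sqrt (2 / k) ^ m * (2 / k)"
    using power_add[of "sqrt (2 / k)" m 2] by simp
  moreover have "1 - m / k = 2 / k * ((real k - real m) / 2)"
    using assms by (simp add: diff_divide_distrib)
  ultimately show ?thesis
    by (simp only: weight_def mult_ac flip: R_def)
qed

text \<open>The argument of \<open>rGamma\<close> is then a nonpositive integer. This lets the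
  finite sum over \<open>m \<le> k\<close> be treated as an infinite series.\<close>

lemma weight_eq_0:
  assumes "k < m" "even (k + m)"
  shows "weight k m = 0"
proof -
  obtain j where j: "m = k + 2 + 2 * j"
  proof -
    from assms have "even (m - k)" by auto
    then obtain i where "m - k = 2 * i" by (rule evenE)
    then have "m = k + 2 + 2 * (i - 1)" using assms(1) by linarith
    then show ?thesis using that by blast
  qed
  have "(real k - real m) / 2 + 1 = - real j"
    unfolding j by (simp add: field_simps)
  then show ?thesis
    by (simp add: weight_def rGamma_eq_zero_iff)
qed

text \<open>Apply \<open>Gamma_plus_half_bound\<close> at \<open>k / 2\<close> for the lower bound
  and at \<open>k / 2 + 1/2\<close> for the upper one. The weight at 1 is therefore not below 1, but
  \<open>b_1 = 0\<close>, so it only serves to control the weight at 3.\<close>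

lemma weight_1_bounds:
  assumes "1 \<le> k"
  shows "1 \<le> weight k 1" "weight k 1 \<le> sqrt (1 + 1 / k)"
proof -
  define g where "g = Gamma (real k / 2 + 1/2)"
  define G where "G = Gamma (real k / 2 + 1)"
  have pos: "0 < g" "0 < G"
    by (auto simp: g_def G_def intro!: Gamma_real_pos add_nonneg_pos)
  have w: "weight k 1 = sqrt (2 / k) * G / g"
  proof -
    have "(real k - real 1) / 2 + 1 = real k / 2 + 1 / 2"
      by (simp add: diff_divide_distrib)
    then show ?thesis
      unfolding weight_def G_def g_def by (simp only: rGamma_inverse_Gamma divide_inverse power_one_right)
  qed
  have G: "G = k / 2 * Gamma (real k / 2)"
    unfolding G_def using assms by (subst Gamma_plus1) (auto simp: )
  have "g ^ 2 \<le> k / 2 * Gamma (real k / 2) ^ 2"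
    unfolding g_def using Gamma_plus_half_bound[of "k / 2"] assms by simp
  also have "\<dots> = 2 / k * G ^ 2"
    unfolding G using assms by (simp add: power2_eq_square)
  finally have "g ^ 2 \<le> (sqrt (2 / k) * G) ^ 2"
    by (simp add: power_mult_distrib)
  then have "g \<le> sqrt (2 / k) * G"
    using pos by (intro power2_le_imp_le[of g]) auto
  then show "1 \<le> weight k 1"
    unfolding w using pos by simp
  have "G ^ 2 \<le> (real k / 2 + 1 / 2) * g ^ 2"
    unfolding G_def g_def using Gamma_plus_half_bound[of "k / 2 + 1/2"] by (simp add: add_ac)
  then have "(sqrt (2 / k) * G) ^ 2 \<le> 2 / k * ((real k / 2 + 1 / 2) * g ^ 2)"
    unfolding power_mult_distrib by (simp add: mult_left_mono divide_right_mono)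
  also have "\<dots> = (sqrt (1 + 1 / k) * g) ^ 2"
    using assms by (simp add: power_mult_distrib add_divide_distrib distrib_right)
  finally have "sqrt (2 / k) * G \<le> sqrt (1 + 1 / k) * g"
    by (rule power2_le_imp_le) (use pos in auto)
  then show "weight k 1 \<le> sqrt (1 + 1 / k)"
    unfolding w using pos by (simp add: divide_le_eq)
qed

text \<open>Multiplying the weight at 1 by \<open>1 - t\<close> with \<open>t = 1 / k\<close>
  compensates its excess, since
  \<open>(1 + t) (1 - t)^2 = (1 - t^2) (1 - t) \<le> 1\<close>.\<close>

lemma weight_3_bounds:
  assumes "1 \<le> k"
  shows "1 - 1 / k \<le> weight k 3" "weight k 3 \<le> 1"
proof -
  define t where "t = 1 / real k"
  have t: "0 \<le> t" "t \<le> 1" using assms by (auto simp: t_def)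
  have w: "weight k 3 = weight k 1 * (1 - t)"
    using weight_add_2[OF assms, of 1] by (simp add: t_def numeral_3_eq_3)
  show "1 - 1 / k \<le> weight k 3"
    unfolding w t_def[symmetric] using mult_right_mono[OF weight_1_bounds(1)[OF assms], of "1 - t"] t by simp
  have "weight k 3 \<le> sqrt (1 + t) * (1 - t)"
    unfolding w using weight_1_bounds(2)[OF assms] t by (intro mult_right_mono) (auto simp: t_def)
  also have "\<dots> \<le> 1"
  proof (rule power2_le_imp_le)
    have "(1 + t) * (1 - t) ^ 2 = (1 - t ^ 2) * (1 - t)"
      by (simp add: power2_eq_square algebra_simps)
    also have "\<dots> \<le> 1 * 1"
      using t by (intro mult_mono) (auto simp: power_le_one)
    finally show "(sqrt (1 + t) * (1 - t))\<^sup>2 \<le> 1\<^sup>2"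
      using t by (simp add: power_mult_distrib)
  qed simp
  finally show "weight k 3 \<le> 1" .
qed

text \<open>Induction in steps of two from the bases 0 and 3. Up to \<open>k\<close> each step
  multiplies by a factor in \<open>[0, 1]\<close>, so the weights decrease along each parity class;
  beyond \<open>k\<close> they vanish and \<open>1 - m^2 / k\<close> is not positive.\<close>

lemma weight_bounds:
  assumes "1 \<le> k" "even (k + m)" "m \<noteq> 1"
  shows "0 \<le> weight k m" "weight k m \<le> 1" "1 - real m ^ 2 / k \<le> weight k m"
    "odd m \<Longrightarrow> weight k m \<le> weight k 3"
proof -
  have "0 \<le> weight k m \<and> weight k m \<le> 1 \<and> 1 - real m ^ 2 / k \<le> weight k m
      \<and> (odd m \<longrightarrow> weight k m \<le> weight k 3)"
    using assms(2,3)
  proof (induction m rule: less_induct)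
    case (less m)
    consider "m = 0" | "m = 3" | n where "m = n + 2" "n \<noteq> 1"
    proof -
      assume "m = 0 \<Longrightarrow> thesis" "m = 3 \<Longrightarrow> thesis"
        and n: "\<And>n. m = n + 2 \<Longrightarrow> n \<noteq> 1 \<Longrightarrow> thesis"
      moreover have "m = m - 2 + 2 \<and> m - 2 \<noteq> 1" if "m \<noteq> 0" "m \<noteq> 3"
        using that less.prems by auto
      ultimately show thesis by blast
    qed
    then show ?case
    proof cases
      case 2
      have "1 - real 3 ^ 2 / k \<le> 1 - 1 / k" "0 \<le> 1 - 1 / real k"
        using assms(1) by (auto simp: field_simps)
      then show ?thesis
        using weight_3_bounds[OF assms(1)] 2 by (simp)
    next
      case 3
      have IH: "0 \<le> weight k n" "weight k n \<le> 1" "1 - real n ^ 2 / k \<le> weight k n"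
        "odd n \<Longrightarrow> weight k n \<le> weight k 3"
        using less.IH[of n] less.prems 3 by auto
      have w: "weight k m = weight k n * (1 - n / k)"
        using weight_add_2[OF assms(1)] 3 by simp
      show ?thesis
      proof (cases "n \<le> k")
        case True
        then have f: "0 \<le> 1 - n / real k" "1 - n / real k \<le> 1"
          using assms(1) by (auto simp: divide_simps)
        have le: "weight k m \<le> weight k n"
          unfolding w using IH f by (intro mult_left_le) auto
        \<comment> \<open>Because \<open>(n + 2)^2 \<ge> n^2 + n\<close>; as the previous weight is
          at most 1, a step costs at most \<open>n / k\<close> additively.\<close>
        have "1 - real m ^ 2 / k \<le> 1 - real n ^ 2 / k - n / k"
          using assms(1) 3 by (auto simp: divide_simps power2_eq_square algebra_simps)
        also have "\<dots> \<le> weight k n - 1 * (n / k)"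
          using IH by simp
        also have "\<dots> \<le> weight k n - weight k n * (n / k)"
          using IH by (intro diff_left_mono mult_right_mono) auto
        finally have "1 - real m ^ 2 / k \<le> weight k m"
          unfolding w by (simp add: algebra_simps)
        moreover have "0 \<le> weight k m"
          unfolding w using IH f by simp
        ultimately show ?thesis
          using le IH(2,4) 3 by auto
      next
        case False
        then have "k < m" using 3 by simp
        then have "weight k m = 0" using weight_eq_0 less.prems by blast
        moreover have "real k * 1 \<le> real m * real m"
          using \<open>k < m\<close> by (intro mult_mono) auto
        moreover have "0 \<le> weight k 3"
          using weight_3_bounds(1)[OF assms(1)] assms(1) by (auto intro: order_trans[rotated])
        ultimately show ?thesis
          using assms(1) by (simp add: divide_simps power2_eq_square)
      qed
    qed (auto)
  qed
  then show "0 \<le> weight k m" "weight k m \<le> 1" "1 - real m ^ 2 / k \<le> weight k m"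
    "odd m \<Longrightarrow> weight k m \<le> weight k 3" by auto
qed

section \<open>The normalised moment as a weighted series\<close>

lemma gauss_moment_Gamma_pos: "0 < gauss_moment_Gamma k"
  by (auto simp: gauss_moment_Gamma_def intro!: divide_pos_pos mult_pos_pos Gamma_real_pos add_nonneg_pos)

lemma gauss_moment_Gamma_even: "even k \<Longrightarrow> gauss_moment_Gamma k = gauss_moment k"
proof (elim evenE)
  fix b assume "k = 2 * b"
  then show ?thesis
    using Gamma_fact[of b, where 'a = real]
    by (simp add: gauss_moment_Gamma_def gauss_moment_def powr_realpow add.commute)
qed

text \<open>Write \<open>k = m + 2 * j\<close>. The \<open>Gamma\<close> factor of the weight
  cancels the one in \<open>gauss_moment_Gamma\<close>, its \<open>rGamma\<close> factor is
  \<open>1 / j!\<close>, and the remaining powers of 2, \<open>k\<close> and \<open>l\<close>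
  recombine.\<close>

lemma gauss_fps_nth_conv_weight:
  assumes "0 < l" "1 \<le> k" "m \<le> k" "even (k + m)"
  shows "fact k * gauss_fps l $ (k - m) / sqrt l ^ k = gauss_moment_Gamma k * (sqrt (k / l) ^ m * weight k m)"
proof -
  obtain j where j: "k = m + 2 * j"
  proof -
    from assms have "even (k - m)" by auto
    then obtain j where "k - m = 2 * j" by (rule evenE)
    then show ?thesis using that[of j] assms(3) by simp
  qed
  have Gj: "rGamma ((real k - real m) / 2 + 1) = 1 / fact j"
  proof -
    have "(real k - real m) / 2 + 1 = 1 + real j"
      unfolding j by simp
    then show ?thesis
      by (simp only: rGamma_inverse_Gamma Gamma_fact divide_inverse mult_1_left)
  qed
  have G: "Gamma (real k / 2 + 1) \<noteq> 0"
    by (intro Gamma_real_neq_0 add_nonneg_pos) auto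
  have p: "2 powr (real k / 2) = sqrt 2 ^ k"
    using powr_powr[of 2 "1/2" "real k"] by (simp add: powr_half_sqrt powr_realpow)
  have a: "sqrt (k / l) ^ m * sqrt (2 / k) ^ m = sqrt 2 ^ m / sqrt l ^ m"
    using assms by (simp add: real_sqrt_divide real_sqrt_mult power_divide power_mult_distrib)
  have b: "sqrt l ^ k = sqrt l ^ m * l ^ j" "sqrt 2 ^ k = sqrt 2 ^ m * 2 ^ j"
    using assms unfolding j by (auto simp: power_add power_mult)
  have "gauss_moment_Gamma k * (sqrt (k / l) ^ m * weight k m)
      = gauss_moment_Gamma k * Gamma (real k / 2 + 1) * (sqrt (k / l) ^ m * sqrt (2 / k) ^ m) * (1 / fact j)"
    by (simp add: weight_def Gj)
  also have "\<dots> = fact k / (sqrt 2 ^ m * 2 ^ j) * (sqrt 2 ^ m / sqrt l ^ m) / fact j"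
    using G unfolding a gauss_moment_Gamma_def p b(2) by simp
  also have "\<dots> = fact k * ((l / 2) ^ j / fact j) / sqrt l ^ k"
    using assms(1) unfolding b(1) by (simp add: power_divide)
  also have "\<dots> = fact k * gauss_fps l $ (k - m) / sqrt l ^ k"
    by (simp add: gauss_fps_def j)
  finally show ?thesis by simp
qed

text \<open>The Cauchy product for the central moment, in which wrong parities drop out because
  \<open>gauss_fps\<close> is even. Stating it as an infinite series allows termwise comparison with
  the series of \<open>B\<close>.\<close>

lemma poisson_std_moment_sums:
  assumes "0 < l" "1 \<le> k"
  shows "(\<lambda>m. if even (k + m) then excess_fps l $ m * sqrt (k / l) ^ m * weight k m else 0)
    sums (poisson_std_moment l k / gauss_moment_Gamma k)"
proof -
  have "poisson_std_moment l k
      = measure_pmf.expectation (poisson_pmf l) (\<lambda>n. (real n - l) ^ k) / sqrt l ^ k"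
    by (simp add: poisson_std_moment_def power_divide)
  also have "\<dots> = (\<Sum>m=0..k. excess_fps l $ m * (fact k * gauss_fps l $ (k - m) / sqrt l ^ k))"
    using assms(1)
    by (simp add: poisson_central_moment_eq fps_mult_nth sum_distrib_left sum_divide_distrib mult_ac)
  also have "\<dots> = (\<Sum>m=0..k. gauss_moment_Gamma k *
      (if even (k + m) then excess_fps l $ m * sqrt (k / l) ^ m * weight k m else 0))"
  proof (rule sum.cong[OF refl])
    fix m assume m: "m \<in> {0..k}"
    show "excess_fps l $ m * (fact k * gauss_fps l $ (k - m) / sqrt l ^ k)
      = gauss_moment_Gamma k * (if even (k + m) then excess_fps l $ m * sqrt (k / l) ^ m * weight k m else 0)"
    proof (cases "even (k + m)")
      case True
      then show ?thesis using gauss_fps_nth_conv_weight[of l k m] assms m by simp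
    next
      case False
      then show ?thesis using m by (simp add: gauss_fps_def)
    qed
  qed
  finally have "poisson_std_moment l k / gauss_moment_Gamma k
      = (\<Sum>m\<in>{0..k}. if even (k + m) then excess_fps l $ m * sqrt (k / l) ^ m * weight k m else 0)"
    using gauss_moment_Gamma_pos[of k] by (simp flip: sum_distrib_left)
  then show ?thesis
    by (simp only:) (rule sums_finite, auto simp: weight_eq_0)
qed

lemma parity_sums:
  fixes f :: "nat \<Rightarrow> real"
  assumes "(\<lambda>m. f m * x ^ m) sums a" "(\<lambda>m. f m * (- x) ^ m) sums b"
  shows "(\<lambda>m. if even (k + m) then f m * x ^ m else 0) sums ((a + (-1) ^ k * b) / 2)"
proof -
  have "(\<lambda>m. (f m * x ^ m + (-1) ^ k * (f m * (- x) ^ m)) / 2) sums ((a + (-1) ^ k * b) / 2)"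
    by (intro sums_divide sums_add sums_mult assms)
  moreover have "(\<lambda>m. (f m * x ^ m + (-1) ^ k * (f m * (- x) ^ m)) / 2)
      = (\<lambda>m. if even (k + m) then f m * x ^ m else 0)"
    by (rule ext, cases "even k"; case_tac "even m") auto
  ultimately show ?thesis by simp
qed

text \<open>The value is \<open>x^2 B''(x)\<close>: the series is differentiated termwise twice, and
  the closed form comes from \<open>B' = l (e^x - 1 - x) B\<close> and uniqueness of
  derivatives.\<close>

lemma excess_fps_second_moment_sums:
  fixes l x :: real
  shows "(\<lambda>m. real m * (real m - 1) * (excess_fps l $ m * x ^ m)) sums
    (x\<^sup>2 * (excess_exp l x * (l\<^sup>2 * (exp x - 1 - x)\<^sup>2 + l * (exp x - 1))))"
proof -
  define B where "B = excess_exp l"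
  define b where "b = fps_nth (excess_fps l)"
  have sB: "(\<lambda>n. b n * y ^ n) sums B y" for y
    unfolding b_def B_def by (rule excess_fps_sums)
  have s0: "summable (\<lambda>n. b n * y ^ n)" for y
    using sB by (rule sums_summable)
  have s1: "summable (\<lambda>n. diffs b n * y ^ n)" for y
    using s0 by (rule termdiff_converges_all)
  have s2: "summable (\<lambda>n. diffs (diffs b) n * y ^ n)" for y
    using s1 by (rule termdiff_converges_all)
  have B: "B = (\<lambda>y. \<Sum>n. b n * y ^ n)"
    using sB by (simp add: fun_eq_iff sums_iff)
  define B1 where "B1 = (\<lambda>y. B y * (l * (exp y - 1 - y)))"
  have "(B has_field_derivative B1 y) (at y)" for y
    unfolding B_def B1_def excess_exp_def by (auto intro!: derivative_eq_intros simp: diff_diff_eq)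
  moreover have "(B has_field_derivative (\<Sum>n. diffs b n * y ^ n)) (at y)" for y
    unfolding B by (rule termdiffs_strong_converges_everywhere[OF s0])
  ultimately have B1: "B1 = (\<lambda>y. \<Sum>n. diffs b n * y ^ n)"
    using DERIV_unique by blast
  have "(B1 has_field_derivative (B x * (l\<^sup>2 * (exp x - 1 - x)\<^sup>2 + l * (exp x - 1)))) (at x)"
    unfolding B_def B1_def excess_exp_def
    by (auto intro!: derivative_eq_intros simp: algebra_simps power2_eq_square)
  moreover have "(B1 has_field_derivative (\<Sum>n. diffs (diffs b) n * x ^ n)) (at x)"
    unfolding B1 by (rule termdiffs_strong_converges_everywhere[OF s1])
  ultimately have "(\<Sum>n. diffs (diffs b) n * x ^ n) = B x * (l\<^sup>2 * (exp x - 1 - x)\<^sup>2 + l * (exp x - 1))"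
    using DERIV_unique by blast
  then have "(\<lambda>n. diffs (diffs b) n * x ^ n) sums (B x * (l\<^sup>2 * (exp x - 1 - x)\<^sup>2 + l * (exp x - 1)))"
    using s2 by (metis summable_sums)
  then have "(\<lambda>n. x\<^sup>2 * (diffs (diffs b) n * x ^ n)) sums (x\<^sup>2 * (B x * (l\<^sup>2 * (exp x - 1 - x)\<^sup>2 + l * (exp x - 1))))"
    by (rule sums_mult)
  also have "(\<lambda>n. x\<^sup>2 * (diffs (diffs b) n * x ^ n))
      = (\<lambda>n. real (n + 2) * (real (n + 2) - 1) * (b (n + 2) * x ^ (n + 2)))"
    by (auto simp: diffs_def fun_eq_iff power_add power2_eq_square algebra_simps)
  finally have "(\<lambda>m. real m * (real m - 1) * (b m * x ^ m)) sums
      (x\<^sup>2 * (B x * (l\<^sup>2 * (exp x - 1 - x)\<^sup>2 + l * (exp x - 1))) +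
        (\<Sum>m<2. real m * (real m - 1) * (b m * x ^ m)))"
    by (subst (asm) sums_iff_shift)
  \<comment> \<open>The two terms lost in the shift by 2 vanish, as \<open>m (m - 1) = 0\<close> for
    \<open>m < 2\<close>.\<close>
  then show ?thesis
    by (simp add: numeral_2_eq_2 b_def B_def)
qed

definition moment_ratio :: "real \<Rightarrow> nat \<Rightarrow> real" where
  "moment_ratio l k = inverse (gauss_moment_Gamma k) * poisson_std_moment l k"

text \<open>By \<open>parity_sums\<close>, this is the series of \<open>b_m r^m\<close> over
  \<open>m\<close> of the parity of \<open>k\<close>, that is, the normalised moment with all
  weights replaced by 1.\<close>

definition parity_exp :: "real \<Rightarrow> nat \<Rightarrow> real" where
  "parity_exp l k = (excess_exp l (sqrt (k / l)) + (-1) ^ k * excess_exp l (- sqrt (k / l))) / 2"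

text \<open>Termwise comparison of the weighted series \<open>s\<close> with the unweighted series
  \<open>t\<close>. Since all terms are nonnegative, the summand at 0 or 3 alone is a lower bound.
  For odd \<open>k\<close> the largest relevant weight is the one at 3, which can be taken out as a
  factor.\<close>

lemma moment_ratio_bounds:
  fixes l :: real
  assumes "0 < l" "1 \<le> k"
  defines "r \<equiv> sqrt (k / l)"
  defines "T \<equiv> parity_exp l k"
  defines "S \<equiv> moment_ratio l k"
  shows "S \<le> T"
    and "T - S \<le> 3 / 2 * excess_exp l r * (l * (exp r - 1 - r)\<^sup>2 + (exp r - 1))"
    and "even k \<Longrightarrow> 1 \<le> S"
    and "odd k \<Longrightarrow> l / 6 * r ^ 3 * weight k 3 \<le> S"
    and "odd k \<Longrightarrow> S \<le> weight k 3 * T"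
proof -
  define b where "b = fps_nth (excess_fps l)"
  define s where "s = (\<lambda>m. if even (k + m) then b m * r ^ m * weight k m else 0)"
  define t where "t = (\<lambda>m. if even (k + m) then b m * r ^ m else 0)"
  have r: "0 \<le> r" "r\<^sup>2 = k / l" using assms(1) by (auto simp: r_def)
  have b: "0 \<le> b m" "b 0 = 1" "b (Suc 0) = 0" "b 2 = 0" "b 3 = l / 6" for m
    using assms(1) by (auto simp: b_def excess_fps_nonneg excess_fps_nth_3)
  have br: "0 \<le> b m * r ^ m" for m using b r by simp
  have S: "s sums S"
    using poisson_std_moment_sums[OF assms(1,2)]
    unfolding s_def S_def b_def r_def moment_ratio_def by (simp only: divide_inverse mult.commute[of "inverse _"])
  have T: "t sums T"
    using parity_sums[OF excess_fps_sums[of l r] excess_fps_sums[of l "- r"]]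
    unfolding t_def T_def b_def r_def parity_exp_def .
  have s_nonneg: "0 \<le> s m" and s_le: "s m \<le> t m" and s_le3: "odd k \<Longrightarrow> s m \<le> weight k 3 * t m" for m
  proof -
    have "0 \<le> s m \<and> s m \<le> t m \<and> (odd k \<longrightarrow> s m \<le> weight k 3 * t m)"
    \<comment> \<open>The index 1 escapes the weight bounds, but its coefficient is zero.\<close>
    proof (cases "m = 1 \<or> odd (k + m)")
      case True
      then show ?thesis using b by (auto simp: s_def t_def)
    next
      case False
      then have w: "0 \<le> weight k m" "weight k m \<le> 1" "odd m \<Longrightarrow> weight k m \<le> weight k 3"
        using weight_bounds[OF assms(2)] by auto
      moreover have "b m * r ^ m * weight k m \<le> b m * r ^ m * weight k 3" if "odd m"
        using w(3) br that by (intro mult_left_mono) auto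
      ultimately show ?thesis
        using False br[of m] mult_left_le[OF w(2) br[of m]] mult_nonneg_nonneg[OF br[of m] w(1)]
        unfolding s_def t_def by (auto simp: mult.commute[of "weight k 3"])
    qed
    then show "0 \<le> s m" "s m \<le> t m" "odd k \<Longrightarrow> s m \<le> weight k 3 * t m" by auto
  qed
  show "S \<le> T"
    using s_le S T by (rule sums_le)
  show "S \<le> weight k 3 * T" if "odd k"
    using s_le3[OF that] S sums_mult[OF T] by (rule sums_le)
  have single: "s m \<le> S" for m
    using sum_le_suminf[of s "{m}"] S s_nonneg by (simp add: sums_iff)
  show "1 \<le> S" if "even k"
    using single[of 0] that b by (simp add: s_def)
  show "l / 6 * r ^ 3 * weight k 3 \<le> S" if "odd k"
    using single[of 3] that b by (simp add: s_def)
  have "t m - s m \<le> 3 / (2 * k) * (real m * (real m - 1) * (b m * r ^ m))" for m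
  proof (cases "m = 0 \<or> m = 1 \<or> m = 2")
    case True
    then show ?thesis using b by (auto simp: s_def t_def)
  next
    case False
    then have m: "3 \<le> real m" by auto
    have "0 \<le> real m * (real m - 3)" using m by simp
    \<comment> \<open>The factor 3/2 is the largest value of \<open>m / (m - 1)\<close> for
      \<open>m \<ge> 3\<close>; smaller indices contribute no loss, since
      \<open>weight k 0 = 1\<close> and \<open>b_1 = b_2 = 0\<close>.\<close>
    then have m2: "(real m)\<^sup>2 \<le> 3 / 2 * (real m * (real m - 1))"
      by (simp add: algebra_simps power2_eq_square)
    show ?thesis
    proof (cases "even (k + m)")
      case True
      have "1 - weight k m \<le> (real m)\<^sup>2 / k"
        using weight_bounds(3)[OF assms(2) True] False by simp
      also have "\<dots> \<le> 3 / 2 * (real m * (real m - 1)) / k"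
        using m2 by (rule divide_right_mono) simp
      finally have "b m * r ^ m * (1 - weight k m) \<le> b m * r ^ m * (3 / 2 * (real m * (real m - 1)) / k)"
        using br by (rule mult_left_mono)
      moreover have "t m - s m = b m * r ^ m * (1 - weight k m)"
        using True by (simp add: s_def t_def algebra_simps)
      moreover have "B * (3 / 2 * X / k) = 3 / (2 * k) * (X * B)" for B X :: real
        by simp
      ultimately show ?thesis by (simp only:)
    next
      case False
      then show ?thesis
        using br[of m] m by (auto simp: s_def t_def intro!: mult_nonneg_nonneg divide_nonneg_nonneg)
    qed
  qed
  then have "T - S \<le> 3 / (2 * k) * (r\<^sup>2 * (excess_exp l r * (l\<^sup>2 * (exp r - 1 - r)\<^sup>2 + l * (exp r - 1))))"
    using sums_diff[OF T S] unfolding b_def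
    by (rule sums_le) (intro sums_mult excess_fps_second_moment_sums)
  also have "\<dots> = 3 / 2 * excess_exp l r * (l * (exp r - 1 - r)\<^sup>2 + (exp r - 1))"
  proof -
    have "3 / (2 * k) * (k / l * (b * (l\<^sup>2 * X\<^sup>2 + l * Y))) = 3 / 2 * b * (l * X\<^sup>2 + Y)" for b X Y :: real
      using assms(1,2) by (simp add: field_simps power2_eq_square)
    then show ?thesis unfolding r(2) .
  qed
  finally show "T - S \<le> 3 / 2 * excess_exp l r * (l * (exp r - 1 - r)\<^sup>2 + (exp r - 1))" .
qed

section \<open>Orders up to the cube root\<close>

lemma exp_Taylor_remainder:
  fixes x :: real
  shows "\<bar>exp x - (\<Sum>m<n. x ^ m / fact m)\<bar> \<le> exp \<bar>x\<bar> * \<bar>x\<bar> ^ n / fact n"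
proof -
  obtain t where t: "\<bar>t\<bar> \<le> \<bar>x\<bar>" "exp x = (\<Sum>m<n. x ^ m / fact m) + exp t / fact n * x ^ n"
    using Maclaurin_exp_le by blast
  have "exp t \<le> exp \<bar>x\<bar>" using t(1) by simp
  then have "exp t * \<bar>x\<bar> ^ n / fact n \<le> exp \<bar>x\<bar> * \<bar>x\<bar> ^ n / fact n"
    by (intro divide_right_mono mult_right_mono) auto
  then show ?thesis
    using t(2) by (simp add: abs_mult power_abs)
qed

text \<open>Averaging the Taylor estimates at \<open>r\<close> and \<open>- r\<close> cancels the
  linear and cubic terms.\<close>

lemma cosh_minus_quadratic_le:
  fixes r :: real
  assumes "0 \<le> r"
  shows "cosh r - 1 - r\<^sup>2 / 2 \<le> exp r * r ^ 4 / 24"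
proof -
  have "exp x - (1 + x + x\<^sup>2 / 2 + x ^ 3 / 6) \<le> exp \<bar>x\<bar> * \<bar>x\<bar> ^ 4 / 24" for x :: real
    using exp_Taylor_remainder[of x 4, THEN abs_le_D1]
    by (simp add: lessThan_nat_numeral lessThan_Suc fact_numeral)
  from this[of r] this[of "- r"] have
    "exp r - (1 + r + r\<^sup>2 / 2 + r ^ 3 / 6) \<le> exp r * r ^ 4 / 24"
    "exp (- r) - (1 - r + r\<^sup>2 / 2 - r ^ 3 / 6) \<le> exp r * r ^ 4 / 24"
    using assms by simp_all
  then have "(exp r + exp (- r)) / 2 - 1 - r\<^sup>2 / 2 \<le> exp r * r ^ 4 / 24"
    by argo
  then show ?thesis
    by (simp add: cosh_field_def)
qed

text \<open>Half the difference of the fifth-order estimates at \<open>r\<close> and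
  \<open>- r\<close>. The factor \<open>r^3 / 6\<close> is kept outside because it also occurs in
  the main term for odd \<open>k\<close>.\<close>

lemma sinh_minus_linear_le:
  fixes r :: real
  assumes "0 \<le> r"
  shows "sinh r - r \<le> r ^ 3 / 6 * (1 + exp r * r\<^sup>2)"
proof -
  have t: "\<bar>exp x - (1 + x + x\<^sup>2 / 2 + x ^ 3 / 6 + x ^ 4 / 24)\<bar> \<le> exp \<bar>x\<bar> * \<bar>x\<bar> ^ 5 / 120" for x :: real
    using exp_Taylor_remainder[of x 5] by (simp add: eval_nat_numeral fact_numeral)
  have "exp r - (1 + r + r\<^sup>2 / 2 + r ^ 3 / 6 + r ^ 4 / 24) \<le> exp r * r ^ 5 / 120"
    "1 - r + r\<^sup>2 / 2 - r ^ 3 / 6 + r ^ 4 / 24 - exp (- r) \<le> exp r * r ^ 5 / 120"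
    using abs_le_D1[OF t[of r]] abs_le_D2[OF t[of "- r"]] assms by simp_all
  then have "(exp r - exp (- r)) / 2 - r \<le> r ^ 3 / 6 + exp r * r ^ 5 / 120"
    by argo
  then have "sinh r - r \<le> r ^ 3 / 6 + exp r * r ^ 5 / 120"
    by (simp add: sinh_field_def)
  also have "\<dots> \<le> r ^ 3 / 6 * (1 + exp r * r\<^sup>2)"
  proof -
    have "0 \<le> exp r * r ^ 5" using assms by simp
    then show ?thesis by (simp add: field_simps eval_nat_numeral)
  qed
  finally show ?thesis .
qed

lemma le_sinh:
  fixes r :: real
  assumes "0 \<le> r"
  shows "r \<le> sinh r"
proof -
  have "sinh 0 - 0 \<le> sinh r - r"
  proof (rule DERIV_nonneg_imp_nondecreasing[OF assms])
    fix y :: real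
    show "\<exists>z. ((\<lambda>x. sinh x - x) has_real_derivative z) (at y) \<and> 0 \<le> z"
      by (intro exI[of _ "cosh y - 1"]) (auto intro!: derivative_eq_intros simp: cosh_real_ge_1)
  qed
  then show ?thesis by simp
qed

lemma sinh_le_mult_cosh:
  fixes s :: real
  assumes "0 \<le> s"
  shows "sinh s \<le> s * cosh s"
proof -
  have "0 * cosh 0 - sinh 0 \<le> s * cosh s - sinh s"
  proof (rule DERIV_nonneg_imp_nondecreasing[OF assms])
    fix x :: real assume "0 \<le> x"
    then show "\<exists>y. ((\<lambda>x. x * cosh x - sinh x) has_real_derivative y) (at x) \<and> 0 \<le> y"
      by (intro exI[of _ "x * sinh x"]) (auto intro!: derivative_eq_intros)
  qed
  then show ?thesis by simp
qed

text \<open>The difference of the logarithms has derivative \<open>x - tanh x \<ge> 0\<close>. A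
  bound quadratic in the exponent is what makes the relative error of order \<open>k^3 / l\<close>
  instead of its square root.\<close>

lemma cosh_le_exp_half_square:
  fixes s :: real
  assumes "0 \<le> s"
  shows "cosh s \<le> exp (s\<^sup>2 / 2)"
proof -
  have "0\<^sup>2 / 2 - ln (cosh 0) \<le> s\<^sup>2 / 2 - ln (cosh s)"
  proof (rule DERIV_nonneg_imp_nondecreasing[OF assms])
    fix x :: real assume x: "0 \<le> x"
    have "((\<lambda>x. x\<^sup>2 / 2 - ln (cosh x)) has_real_derivative (x - sinh x / cosh x)) (at x)"
      by (rule derivative_eq_intros refl cosh_real_pos | simp)+
    moreover have "0 \<le> x - sinh x / cosh x"
      using sinh_le_mult_cosh[OF x] by (simp add: divide_le_eq)
    ultimately show "\<exists>y. ((\<lambda>x. x\<^sup>2 / 2 - ln (cosh x)) has_real_derivative y) (at x) \<and> 0 \<le> y"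
      by blast
  qed
  then have "ln (cosh s) \<le> s\<^sup>2 / 2" by simp
  then have "exp (ln (cosh s)) \<le> exp (s\<^sup>2 / 2)"
    by (simp only: exp_le_cancel_iff)
  then show ?thesis
    by (simp only: exp_ln cosh_real_pos)
qed

section \<open>The main term and its comparison with the moment\<close>

definition main_term :: "real \<Rightarrow> nat \<Rightarrow> real" where
  "main_term l k = gauss_moment k + real k * (real k - 1) * gauss_moment (k - 1) / (6 * sqrt l)"

lemma main_term_even:
  assumes "even k" "1 \<le> k"
  shows "main_term l k = gauss_moment_Gamma k"
proof -
  have "gauss_moment (k - 1) = 0"
    using assms unfolding gauss_moment_def by simp
  then show ?thesis
    unfolding main_term_def gauss_moment_Gamma_even[OF assms(1)] by simp
qed

text \<open>The right side is the summand \<open>m = 3\<close> of the weighted series, with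
  \<open>b_3 = l / 6\<close>. For \<open>k = 1\<close> both sides vanish, the right one because
  \<open>weight 1 3 = 0\<close>.\<close>

lemma main_term_odd:
  assumes "0 < l" "odd k"
  shows "main_term l k = gauss_moment_Gamma k * (l / 6 * sqrt (k / l) ^ 3 * weight k 3)"
proof (cases "k = 1")
  case True
  then show ?thesis using weight_add_2[of 1 1] by (simp add: main_term_def gauss_moment_def numeral_3_eq_3)
next
  case False
  have "\<exists>j. k = 2 * j + 3"
    using False assms(2) by (intro exI[of _ "(k - 3) div 2"]) (auto elim!: oddE)
  then obtain j where j: "k = 2 * j + 3" by blast
  have "gauss_moment_Gamma k * (l / 6 * sqrt (k / l) ^ 3 * weight k 3)
      = l / 6 * (fact k * gauss_fps l $ (k - 3) / sqrt l ^ k)"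
    by (subst gauss_fps_nth_conv_weight) (use assms j in auto)
  also have "sqrt l ^ k = sqrt l * l * l ^ j"
    using assms(1) unfolding j power_add power_mult by (simp add: power3_eq_cube)
  also have "l / 6 * (fact k * gauss_fps l $ (k - 3) / (sqrt l * l * l ^ j))
      = fact k / (6 * sqrt l * 2 ^ j * fact j)"
    using assms(1) by (simp add: gauss_fps_def j power_divide)
  also have "\<dots> = main_term l k"
  proof -
    have k1: "k - 1 = 2 * Suc j" and k: "k = Suc (2 * Suc j)" "real k - 1 = 2 * real (Suc j)"
      by (auto simp: j)
    have "main_term l k = real k * (2 * real (Suc j)) * (fact (2 * Suc j) / (2 ^ Suc j * fact (Suc j))) / (6 * sqrt l)"
      unfolding main_term_def k1 k(2) gauss_moment_def using assms(2) by simp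
    also have "2 ^ Suc j * fact (Suc j) = 2 * real (Suc j) * (2 ^ j * fact j)"
      by simp
    also have "real k * (2 * real (Suc j)) * (fact (2 * Suc j) / (2 * real (Suc j) * (2 ^ j * fact j))) / (6 * sqrt l)
        = (real k * fact (2 * Suc j)) / (6 * sqrt l * 2 ^ j * fact j)"
      by (simp del: of_nat_Suc fact_Suc)
    also have "real k * fact (2 * Suc j) = fact k"
      unfolding k(1) fact_Suc[of "2 * Suc j"] by simp
    finally show ?thesis by simp
  qed
  finally show ?thesis by simp
qed

text \<open>Splitting the exponent into even and odd parts gives
  \<open>B(\<plusminus>r) = exp (c \<plusminus> s)\<close>, so \<open>parity_exp\<close> equals
  \<open>exp c * cosh s\<close> or \<open>exp c * sinh s\<close>. For odd \<open>k\<close> the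
  factor \<open>weight k 3\<close> occurs both in the main term and in the upper bound; the
  remaining factor \<open>l / 6 * r ^ 3\<close> is left multiplied out.\<close>

lemma main_term_bounds:
  fixes l :: real
  assumes "0 < l" "1 \<le> k"
  defines "r \<equiv> sqrt (k / l)"
  defines "c \<equiv> l * (cosh r - 1 - r\<^sup>2 / 2)" and "s \<equiv> l * (sinh r - r)"
  shows "main_term l k \<le> poisson_std_moment l k" "0 \<le> main_term l k"
    and "even k \<Longrightarrow> poisson_std_moment l k \<le> main_term l k * (exp c * cosh s)"
    and "odd k \<Longrightarrow> poisson_std_moment l k * (l / 6 * r ^ 3) \<le> main_term l k * (exp c * sinh s)"
proof -
  define M where "M = gauss_moment_Gamma k"
  define S where "S = moment_ratio l k"
  define T where "T = parity_exp l k"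
  have M: "0 < M" by (simp add: M_def gauss_moment_Gamma_pos)
  have E: "poisson_std_moment l k = M * S" using M by (simp add: S_def moment_ratio_def M_def)
  have e: "excess_exp l r = exp c * exp s" "excess_exp l (- r) = exp c * exp (- s)"
  proof -
    have "c + s = l * (exp r - (1 + r + r\<^sup>2 / 2))" "c + - s = l * (exp (- r) - (1 + - r + (- r)\<^sup>2 / 2))"
      unfolding c_def s_def cosh_field_def sinh_field_def
      by (simp_all add: field_simps)
    then show "excess_exp l r = exp c * exp s" "excess_exp l (- r) = exp c * exp (- s)"
      unfolding excess_exp_def by (metis exp_add)+
  qed
  note b = moment_ratio_bounds[OF assms(1,2), folded r_def S_def T_def]
  have w3: "0 \<le> weight k 3"
    using weight_3_bounds(1)[OF assms(2)] assms(2) by (auto intro: order_trans[rotated])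
  have r: "0 \<le> r" using assms(1) by (simp add: r_def)
  show "main_term l k \<le> poisson_std_moment l k"
  proof (cases "even k")
    case True
    then show ?thesis using mult_left_mono[OF b(3), of M] M main_term_even[of k l] assms(2) E by (simp add: M_def)
  next
    case False
    then show ?thesis
      using mult_left_mono[OF b(4) less_imp_le[OF M]] main_term_odd[OF assms(1), of k, folded r_def M_def] E
      by (simp only: not_False_eq_True)
  qed
  show "0 \<le> main_term l k"
  proof (cases "even k")
    case True
    then show ?thesis using M main_term_even[of k l] assms(2) by (simp add: M_def)
  next
    case False
    then show ?thesis
      unfolding main_term_odd[OF assms(1) False, folded r_def M_def] using M r w3 assms(1) by simp
  qed
  show "poisson_std_moment l k \<le> main_term l k * (exp c * cosh s)" if "even k"
  proof -
    have "T = exp c * cosh s"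
      using that unfolding T_def parity_exp_def r_def[symmetric] e by (simp add: cosh_field_def algebra_simps)
    then show ?thesis
      using b(1) M main_term_even[of k l] assms(2) that unfolding E by (simp add: M_def)
  qed
  show "poisson_std_moment l k * (l / 6 * r ^ 3) \<le> main_term l k * (exp c * sinh s)" if "odd k"
  proof -
    have T: "T = exp c * sinh s"
      using that unfolding T_def parity_exp_def r_def[symmetric] e by (simp add: sinh_field_def algebra_simps)
    have "M * (l / 6 * r ^ 3) * S \<le> M * (l / 6 * r ^ 3) * (weight k 3 * T)"
      using b(5)[OF that] M assms(1) r by (intro mult_left_mono) auto
    then show ?thesis
      unfolding E main_term_odd[OF assms(1) that, folded r_def M_def] T by (simp add: mult_ac)
  qed
qed

lemma exp_minus_one_le:
  fixes x :: real
  shows "exp x - 1 \<le> x * exp x"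
proof -
  have "(1 + - x) * exp x \<le> exp (- x) * exp x"
    by (intro mult_right_mono exp_ge_add_one_self) auto
  then show ?thesis
    by (simp add: algebra_simps flip: exp_add)
qed

text \<open>With \<open>q = k^3 / l \<le> A^3\<close>, both \<open>c\<close> and \<open>s^2\<close>
  are \<open>O(q)\<close>, so the moment lies between the main term and \<open>exp (D * q)\<close>
  times it.\<close>

lemma moment_below_cube_root:
  fixes A :: real
  assumes "0 < A"
  shows "\<exists>C::real. \<forall>l>0. \<forall>k::nat. 1 \<le> k \<and> real k \<le> A * l powr (1/3) \<longrightarrow>
        (\<exists>\<theta>::real. \<bar>\<theta>\<bar> \<le> C * (real k ^ 3 / l) \<and> poisson_std_moment l k = main_term l k * (1 + \<theta>))"
proof -
  \<comment> \<open>\<open>R\<close> bounds \<open>exp r\<close>. In \<open>D\<close>, the summand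
    \<open>R\<close> pays for the factor \<open>1 + exp r * r^2\<close> of the odd case,
    \<open>R / 24\<close> for \<open>c\<close>, and the last one for \<open>s^2 / 2\<close>.\<close>
  define R where "R = exp (1 + A ^ 3)"
  define D where "D = R + R / 24 + (1 + R * A ^ 3)\<^sup>2 / 72"
  have R: "0 < R" by (simp add: R_def)
  have D: "0 \<le> D" using R assms by (auto simp: D_def intro!: add_nonneg_nonneg)
  have "\<exists>\<theta>::real. \<bar>\<theta>\<bar> \<le> D * exp (D * A ^ 3) * (real k ^ 3 / l) \<and> poisson_std_moment l k = main_term l k * (1 + \<theta>)"
    if l: "0 < l" and k: "1 \<le> k" and kA: "real k \<le> A * l powr (1/3)" for l k
  proof -
    define q where "q = real k ^ 3 / l"
    define r where "r = sqrt (k / l)"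
    define x where "x = l / 6 * r ^ 3"
    define c where "c = l * (cosh r - 1 - r\<^sup>2 / 2)"
    define s where "s = l * (sinh r - r)"
    have q0: "0 \<le> q" using l by (simp add: q_def)
    have "real k ^ 3 \<le> (A * l powr (1/3)) ^ 3"
      using kA by (rule power_mono) simp
    also have "\<dots> = A ^ 3 * l"
      using l by (simp add: power_mult_distrib powr_powr flip: powr_realpow)
    finally have q: "q \<le> A ^ 3"
      using l by (simp add: q_def divide_le_eq)
    have r0: "0 < r" and r2: "r\<^sup>2 = k / l" using l k by (auto simp: r_def)
    have "real k * 1 \<le> real k * (real k * real k)"
      using k mult_mono[of 1 "real k" 1 "real k"] by (intro mult_left_mono) auto
    then have r2q: "r\<^sup>2 \<le> q"
      unfolding r2 q_def using l by (intro divide_right_mono) (auto simp: eval_nat_numeral mult_ac)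
    \<comment> \<open>This yields \<open>r \<le> 1 + r^2 \<le> 1 + q \<le> 1 + A^3\<close>, the
      exponent chosen in \<open>R\<close>.\<close>
    have "2 * r \<le> 1 + r\<^sup>2"
      using zero_le_power2[of "r - 1"] by (simp add: power2_diff)
    then have "r \<le> 1 + A ^ 3" using r2q q r0 by linarith
    then have eR: "exp r \<le> R" by (simp add: R_def)
    have l4: "l * r ^ 4 \<le> q"
    proof -
      have "l * r ^ 4 = l * (r\<^sup>2)\<^sup>2" by simp
      also have "\<dots> = (real k)\<^sup>2 / l" unfolding r2 using l by (simp add: power2_eq_square)
      also have "\<dots> \<le> q"
        unfolding q_def using l k by (intro divide_right_mono power_increasing) auto
      finally show ?thesis .
    qed
    have x0: "0 < x" using l r0 by (simp add: x_def)
    have x2: "x\<^sup>2 = q / 36"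
    proof -
      have "x\<^sup>2 = l\<^sup>2 / 36 * (r\<^sup>2) ^ 3" by (simp add: x_def power_mult_distrib power_divide flip: power_mult)
      then show ?thesis unfolding r2 q_def using l by (simp add: power_divide eval_nat_numeral)
    qed
    have "c \<le> l * (exp r * r ^ 4 / 24)"
      unfolding c_def using cosh_minus_quadratic_le[of r] r0 l by (intro mult_left_mono) auto
    also have "\<dots> = exp r * (l * r ^ 4) / 24" by simp
    also have "\<dots> \<le> R * q / 24"
      using eR l4 R l r0 by (intro divide_right_mono mult_mono) auto
    finally have c: "c \<le> R / 24 * q" by simp
    have "s \<le> l * (r ^ 3 / 6 * (1 + exp r * r\<^sup>2))"
      unfolding s_def using sinh_minus_linear_le[of r] r0 l by (intro mult_left_mono) auto
    also have "\<dots> = x * (1 + exp r * r\<^sup>2)" by (simp add: x_def)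
    finally have s: "s \<le> x * (1 + exp r * r\<^sup>2)" .
    have er2: "exp r * r\<^sup>2 \<le> R * q"
      using eR r2q R by (intro mult_mono) auto
    have s0: "0 \<le> s"
    proof -
      have "r \<le> sinh r"
        using r0 by (intro le_sinh) simp
      then show ?thesis using l by (simp add: s_def)
    qed
    have "exp r * r\<^sup>2 \<le> R * A ^ 3"
      using er2 q R mult_left_mono[of q "A ^ 3" R] by linarith
    then have "s \<le> x * (1 + R * A ^ 3)"
      using s x0 mult_left_mono[of "1 + exp r * r\<^sup>2" "1 + R * A ^ 3" x] by linarith
    then have "s\<^sup>2 \<le> (x * (1 + R * A ^ 3))\<^sup>2"
      using s0 by (rule power_mono)
    then have s2: "s\<^sup>2 / 2 \<le> (1 + R * A ^ 3)\<^sup>2 / 72 * q"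
      by (simp add: power_mult_distrib x2 mult.commute)
    have main: "poisson_std_moment l k \<le> main_term l k * exp (D * q)"
    proof (cases "even k")
      case True
      have "exp c * cosh s \<le> exp c * exp (s\<^sup>2 / 2)"
        using cosh_le_exp_half_square[OF s0] by simp
      also have "\<dots> = exp (c + s\<^sup>2 / 2)" by (simp add: exp_add)
      also have "\<dots> \<le> exp (D * q)"
      proof -
        have "0 \<le> R * q" using R q0 by simp
        then show ?thesis using c s2 by (simp add: D_def algebra_simps)
      qed
      finally show ?thesis
        using main_term_bounds(2,3)[OF l k, folded r_def, folded c_def s_def] True
        by (meson mult_left_mono order_trans)
    next
      case False
      have "exp c * sinh s \<le> exp c * (s * cosh s)"
        using sinh_le_mult_cosh[OF s0] by simp
      also have "\<dots> \<le> exp c * (x * (1 + exp r * r\<^sup>2) * exp (s\<^sup>2 / 2))"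
        using cosh_le_exp_half_square[OF s0] s s0 x0 by (intro mult_left_mono mult_mono) auto
      also have "\<dots> \<le> exp c * (x * exp (R * q) * exp (s\<^sup>2 / 2))"
      proof -
        have "1 + exp r * r\<^sup>2 \<le> exp (R * q)"
          using er2 exp_ge_add_one_self[of "R * q"] by linarith
        then show ?thesis using x0 by (intro mult_left_mono mult_right_mono) auto
      qed
      also have "\<dots> = x * exp (R * q + c + s\<^sup>2 / 2)" by (simp add: exp_add)
      also have "\<dots> \<le> x * exp (D * q)"
        using c s2 x0 by (simp add: D_def algebra_simps)
      finally have "exp c * sinh s \<le> x * exp (D * q)" .
      then have "poisson_std_moment l k * x \<le> main_term l k * (x * exp (D * q))"
        using main_term_bounds(2,4)[OF l k, folded r_def, folded c_def s_def x_def] False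
        by (meson mult_left_mono order_trans)
      then show ?thesis using x0 by (simp add: mult_ac)
    qed
    have pos: "0 \<le> D * exp (D * A ^ 3) * q" using D q0 by simp
    show ?thesis
    \<comment> \<open>The main term does vanish at \<open>k = 1\<close>; the upper bound then forces
      the moment to be 0, and the relative error may be taken as 0.\<close>
    proof (cases "main_term l k = 0")
      case True
      then have "poisson_std_moment l k = 0"
        using main main_term_bounds(1)[OF l k] by simp
      then show ?thesis
        using True pos by (intro exI[of _ 0]) (simp add: q_def)
    next
      case False
      then have main_term: "0 < main_term l k" using main_term_bounds(2)[OF l k] by simp
      define \<theta> where "\<theta> = poisson_std_moment l k / main_term l k - 1"
      have "0 \<le> \<theta>" using main_term_bounds(1)[OF l k] main_term by (simp add: \<theta>_def)
      have "\<theta> \<le> exp (D * q) - 1" using main main_term by (simp add: \<theta>_def divide_le_eq mult_ac)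
      also have "\<dots> \<le> D * q * exp (D * q)" using D q0 by (intro exp_minus_one_le)
      also have "\<dots> \<le> D * q * exp (D * A ^ 3)"
        using D q0 q by (intro mult_left_mono) (auto intro!: mult_left_mono)
      finally have "\<bar>\<theta>\<bar> \<le> D * exp (D * A ^ 3) * (real k ^ 3 / l)"
        using \<open>0 \<le> \<theta>\<close> by (simp add: q_def mult_ac)
      moreover have "poisson_std_moment l k = main_term l k * (1 + \<theta>)"
        using main_term by (simp add: \<theta>_def)
      ultimately show ?thesis by blast
    qed
  qed
  then show ?thesis by blast
qed

section \<open>Asymptotics for orders below the square root\<close>

text \<open>The exponents are the logarithms of \<open>B(r)\<close> and \<open>B(- r)\<close>. The
  two-sided estimates serve orders at the cube root, the one-sided ones larger orders; the latter
  follow from the sign of the Lagrange remainder.\<close>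

lemma exp_log_excess_bounds:
  fixes l r :: real
  assumes "0 \<le> l" "0 \<le> r"
  shows "\<bar>l * (exp r - (1 + r + r\<^sup>2 / 2)) - l * r ^ 3 / 6\<bar> \<le> exp r * (l * r ^ 4)"
    and "\<bar>l * (exp (- r) - (1 + - r + (- r)\<^sup>2 / 2)) - - (l * r ^ 3 / 6)\<bar> \<le> exp r * (l * r ^ 4)"
    and "l * r ^ 3 / 6 \<le> l * (exp r - (1 + r + r\<^sup>2 / 2))"
    and "l * (exp (- r) - (1 + - r + (- r)\<^sup>2 / 2)) \<le> 0"
proof -
  have sum4: "(\<Sum>m<4. x ^ m / fact m) = 1 + x + x\<^sup>2 / 2 + x ^ 3 / 6"
    and sum3: "(\<Sum>m<3. x ^ m / fact m) = 1 + x + x\<^sup>2 / 2" for x :: real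
    by (simp_all add: eval_nat_numeral fact_numeral)
  have T4: "\<bar>l * (exp x - (1 + x + x\<^sup>2 / 2)) - l * x ^ 3 / 6\<bar> \<le> exp \<bar>x\<bar> * (l * \<bar>x\<bar> ^ 4)" for x
  proof -
    have "\<bar>exp x - (1 + x + x\<^sup>2 / 2) - x ^ 3 / 6\<bar> \<le> exp \<bar>x\<bar> * \<bar>x\<bar> ^ 4 / 24"
      using exp_Taylor_remainder[of x 4] unfolding sum4 by (simp add: diff_diff_eq fact_numeral)
    also have "\<dots> \<le> exp \<bar>x\<bar> * \<bar>x\<bar> ^ 4"
      by simp
    finally have "l * \<bar>exp x - (1 + x + x\<^sup>2 / 2) - x ^ 3 / 6\<bar> \<le> l * (exp \<bar>x\<bar> * \<bar>x\<bar> ^ 4)"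
      using assms(1) by (rule mult_left_mono)
    moreover have "l * \<bar>y\<bar> = \<bar>l * y\<bar>" for y
      using assms(1) by (simp add: abs_mult)
    ultimately have "\<bar>l * (exp x - (1 + x + x\<^sup>2 / 2) - x ^ 3 / 6)\<bar> \<le> exp \<bar>x\<bar> * (l * \<bar>x\<bar> ^ 4)"
      by (simp only: mult.left_commute)
    then show ?thesis
      by (simp only: right_diff_distrib[of l "_ - _"] times_divide_eq_right)
  qed
  show "\<bar>l * (exp r - (1 + r + r\<^sup>2 / 2)) - l * r ^ 3 / 6\<bar> \<le> exp r * (l * r ^ 4)"
    using T4[of r] assms(2) by simp
  show "\<bar>l * (exp (- r) - (1 + - r + (- r)\<^sup>2 / 2)) - - (l * r ^ 3 / 6)\<bar> \<le> exp r * (l * r ^ 4)"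
    using T4[of "- r"] assms(2) by simp
  obtain t where "exp r = (\<Sum>m<4. r ^ m / fact m) + exp t / fact 4 * r ^ 4"
    using Maclaurin_exp_le[of r 4] by blast
  moreover have "0 \<le> exp t / fact 4 * r ^ 4" by simp
  ultimately have "r ^ 3 / 6 \<le> exp r - (1 + r + r\<^sup>2 / 2)"
    unfolding sum4 by linarith
  then show "l * r ^ 3 / 6 \<le> l * (exp r - (1 + r + r\<^sup>2 / 2))"
    using mult_left_mono[OF _ assms(1), of "r ^ 3 / 6"] by simp
  obtain t where "exp (- r) = (\<Sum>m<3. (- r) ^ m / fact m) + exp t / fact 3 * (- r) ^ 3"
    using Maclaurin_exp_le[of "- r" 3] by blast
  moreover have "0 \<le> exp t / fact 3 * r ^ 3" using assms(2) by simp
  ultimately have "exp (- r) - (1 + - r + (- r)\<^sup>2 / 2) \<le> 0"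
    unfolding sum3 by simp
  then show "l * (exp (- r) - (1 + - r + (- r)\<^sup>2 / 2)) \<le> 0"
    using assms(1) by (rule mult_nonneg_nonpos[rotated])
qed

text \<open>Relative form of the loss bound: \<open>e^r - 1 - r = O(r^2)\<close> turns it into
  \<open>l r^4 + r\<close> up to bounded factors when \<open>r\<close> is bounded, and
  \<open>l r^4 = k^2 / l\<close>.\<close>

lemma parity_exp_minus_moment_ratio:
  assumes "0 < l" "1 \<le> k"
  shows "\<bar>(parity_exp l k - moment_ratio l k) / excess_exp l (sqrt (k / l))\<bar>
    \<le> 3 / 2 * ((exp (sqrt (k / l)))\<^sup>2 * (l * sqrt (k / l) ^ 4) + (exp (sqrt (k / l)) - 1))"
proof -
  define r where "r = sqrt (k / l)"
  have r: "0 \<le> r" using assms by (simp add: r_def)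
  have "\<bar>exp r - 1 - r\<bar> \<le> exp r * r\<^sup>2 / 2"
    using exp_Taylor_remainder[of r 2] r by (simp add: numeral_2_eq_2 diff_diff_eq)
  also have "\<dots> \<le> exp r * r\<^sup>2" by simp
  finally have "(exp r - 1 - r)\<^sup>2 \<le> (exp r * r\<^sup>2)\<^sup>2"
    by (rule power2_le_iff_abs_le[THEN iffD2, rotated]) simp
  then have "l * (exp r - 1 - r)\<^sup>2 \<le> l * (exp r * r\<^sup>2)\<^sup>2"
    using assms(1) by (intro mult_left_mono) auto
  also have "\<dots> = (exp r)\<^sup>2 * (l * r ^ 4)"
    by (simp add: power_mult_distrib)
  finally have le: "l * (exp r - 1 - r)\<^sup>2 \<le> (exp r)\<^sup>2 * (l * r ^ 4)" .
  have pos: "0 < excess_exp l r" by simp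
  have "parity_exp l k - moment_ratio l k \<le> 3 / 2 * excess_exp l r * (l * (exp r - 1 - r)\<^sup>2 + (exp r - 1))"
    using moment_ratio_bounds(2)[OF assms]
    unfolding r_def .
  then have "(parity_exp l k - moment_ratio l k) / excess_exp l r \<le> 3 / 2 * (l * (exp r - 1 - r)\<^sup>2 + (exp r - 1))"
    unfolding pos_divide_le_eq[OF pos] by (simp only: mult_ac)
  moreover have "0 \<le> (parity_exp l k - moment_ratio l k) / excess_exp l r"
    using moment_ratio_bounds(1)[OF assms] by (intro divide_nonneg_pos pos) simp
  moreover have "\<bar>x\<bar> \<le> 3 / 2 * (a' + c)" if "x \<le> 3 / 2 * (a + c)" "0 \<le> x" "a \<le> a'" for x a a' c :: real
    using that by simp
  ultimately show ?thesis
    using le unfolding r_def by blast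
qed

text \<open>Common setting of the regimes at and above the cube root: \<open>k = o(l^(1/2))\<close>
  already makes \<open>r\<close>, \<open>l r^4\<close> and the relative loss tend to 0.\<close>

locale small_order =
  fixes k :: "real \<Rightarrow> nat"
  assumes k_smallo: "(\<lambda>l. real (k l)) \<in> o[at_top](\<lambda>l. l powr (1/2))"
    and k_ge_1: "eventually (\<lambda>l. 1 \<le> k l) at_top"
begin

definition r :: "real \<Rightarrow> real" where
  "r l = sqrt (k l / l)"

lemma eventually_pos: "eventually (\<lambda>l. 0 < l \<and> 1 \<le> k l \<and> 0 \<le> r l) at_top"
  using eventually_gt_at_top[of 0] k_ge_1 by eventually_elim (simp add: r_def)

lemma k_over_sqrt_tendsto_0: "((\<lambda>l. k l / l powr (1/2)) \<longlongrightarrow> 0) at_top"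
  using k_smallo by (rule smalloD_tendsto)

lemma r_tendsto_0: "(r \<longlongrightarrow> 0) at_top"
proof -
  have "((\<lambda>l::real. l powr (- (1/2))) \<longlongrightarrow> 0) at_top"
    by real_asymp
  then have "((\<lambda>l. sqrt (k l / l powr (1/2) * l powr (- (1/2)))) \<longlongrightarrow> sqrt (0 * 0)) at_top"
    by (intro tendsto_real_sqrt tendsto_mult k_over_sqrt_tendsto_0)
  moreover have "eventually (\<lambda>l. sqrt (k l / l powr (1/2) * l powr (- (1/2))) = r l) at_top"
    using eventually_gt_at_top[of 0]
  proof eventually_elim
    case (elim l)
    have "k l / sqrt l * inverse (sqrt l) = k l / l"
      using elim by (simp add: divide_inverse flip: inverse_mult_distrib)
    then show ?case
      using elim by (simp only: r_def powr_minus powr_half_sqrt less_imp_le)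
  qed
  ultimately show ?thesis
    using tendsto_cong by fastforce
qed

lemma exp_r_tendsto_1: "((\<lambda>l. exp (r l)) \<longlongrightarrow> 1) at_top"
  using tendsto_exp[OF r_tendsto_0] by simp

lemma r_pow_4_tendsto_0: "((\<lambda>l. l * r l ^ 4) \<longlongrightarrow> 0) at_top"
proof -
  have "((\<lambda>l. (k l / l powr (1/2)) ^ 2) \<longlongrightarrow> 0 ^ 2) at_top"
    by (intro tendsto_power k_over_sqrt_tendsto_0)
  moreover have "eventually (\<lambda>l. (k l / l powr (1/2)) ^ 2 = l * r l ^ 4) at_top"
    using eventually_gt_at_top[of 0]
  proof eventually_elim
    case (elim l)
    have "r l ^ 4 = (k l / l)\<^sup>2"
      using power_mult[of "r l" 2 2] elim by (simp add: r_def)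
    then show ?case using elim by (simp add: powr_half_sqrt power_divide power2_eq_square)
  qed
  ultimately show ?thesis
    using tendsto_cong by fastforce
qed

lemma exp_r_l_r_pow_4_tendsto_0: "((\<lambda>l. exp (r l) * (l * r l ^ 4)) \<longlongrightarrow> 0) at_top"
  using tendsto_mult[OF exp_r_tendsto_1 r_pow_4_tendsto_0] by simp

lemma error_tendsto_0:
  "((\<lambda>l. (parity_exp l (k l) - moment_ratio l (k l)) / excess_exp l (r l)) \<longlongrightarrow> 0) at_top"
proof (rule Lim_null_comparison)
  show "eventually (\<lambda>l. norm ((parity_exp l (k l) - moment_ratio l (k l)) / excess_exp l (r l))
    \<le> 3 / 2 * ((exp (r l))\<^sup>2 * (l * r l ^ 4) + (exp (r l) - 1))) at_top"
    using eventually_pos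
    by eventually_elim (use parity_exp_minus_moment_ratio in \<open>simp add: r_def\<close>)
  have "((\<lambda>l. 3 / 2 * ((exp (r l))\<^sup>2 * (l * r l ^ 4) + (exp (r l) - 1)))
      \<longlongrightarrow> 3 / 2 * (1\<^sup>2 * 0 + (1 - 1))) at_top"
    by (intro tendsto_intros exp_r_tendsto_1 r_pow_4_tendsto_0)
  then show "((\<lambda>l. 3 / 2 * ((exp (r l))\<^sup>2 * (l * r l ^ 4) + (exp (r l) - 1))) \<longlongrightarrow> 0) at_top"
    by simp
qed

end

text \<open>Expresses \<open>l r^3\<close>, the scale of \<open>ln B(r)\<close>, as the power 3/2 of
  \<open>k / l^(1/3)\<close>, the quantity that separates the regimes.\<close>

lemma order_cubed:
  fixes l y :: real
  assumes "0 < l"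
  shows "l * sqrt (y / l) ^ 3 = sqrt (y / l powr (1/3)) ^ 3"
proof -
  define t where "t = l powr (1/3)"
  have t: "0 < t" using assms by (simp add: t_def)
  have "t ^ 3 = l powr 1"
    unfolding t_def power3_eq_cube powr_add[symmetric] by simp
  then have l: "l = t ^ 3" using assms by simp
  have "y / l = (y / t) * (1 / t)\<^sup>2"
    unfolding l using t by (simp add: power2_eq_square power3_eq_cube)
  then have "sqrt (y / l) = sqrt (y / t) * (1 / t)"
    using t by (simp only: real_sqrt_mult real_sqrt_abs) simp
  then show ?thesis
    unfolding t_def[symmetric] using t by (simp add: l power_mult_distrib power_divide)
qed

section \<open>Orders above the cube root\<close>

text \<open>Here \<open>ln B(r) \<ge> l r^3 / 6\<close> tends to infinity while
  \<open>B(- r) \<le> 1\<close>, so the parity term disappears relative to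
  \<open>B(r)\<close>.\<close>

lemma moment_above_cube_root:
  fixes k :: "real \<Rightarrow> nat"
  assumes large: "filterlim (\<lambda>l. real (k l) / l powr (1/3)) at_top at_top"
    and small: "(\<lambda>l. real (k l)) \<in> o[at_top](\<lambda>l. l powr (1/2))"
  shows "(\<lambda>l. moment_ratio l (k l)) \<sim>[at_top] (\<lambda>l. 1/2 * excess_exp l (sqrt (k l / l)))"
    and "filterlim (\<lambda>l. 1/2 * excess_exp l (sqrt (k l / l))) at_top at_top"
proof -
  have "eventually (\<lambda>l. 1 \<le> real (k l) / l powr (1/3)) at_top"
    using large by (rule filterlim_at_top[THEN iffD1, THEN spec])
  then have k1: "eventually (\<lambda>l. 1 \<le> k l) at_top"
  proof eventually_elim
    case (elim l)
    then show ?case by (cases "k l") auto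
  qed
  interpret small_order k
    using small k1 by unfold_locales
  have cube: "eventually (\<lambda>l. real (k l) / l powr (1/3) / 6 \<le> l * r l ^ 3 / 6) at_top"
    using eventually_pos \<open>eventually (\<lambda>l. 1 \<le> real (k l) / l powr (1/3)) at_top\<close>
  proof eventually_elim
    case (elim l)
    define u where "u = real (k l) / l powr (1/3)"
    have u: "1 \<le> u" using elim by (simp add: u_def)
    have l: "0 < l" using elim by simp
    have "l * r l ^ 3 = u * sqrt u"
      using order_cubed[OF l, of "k l"] u by (simp add: r_def u_def[symmetric] power3_eq_cube)
    moreover have "u * 1 \<le> u * sqrt u" using u by (intro mult_left_mono) auto
    ultimately show ?case unfolding u_def[symmetric] by simp
  qed
  have "filterlim (\<lambda>l. 1 / 6 * (real (k l) / l powr (1/3))) at_top at_top"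
    by (rule filterlim_tendsto_pos_mult_at_top[OF tendsto_const _ large]) simp
  then have "filterlim (\<lambda>l. l * r l ^ 3 / 6) at_top at_top"
    by (rule filterlim_at_top_mono) (use cube in simp)
  then have "filterlim (\<lambda>l. l * (exp (r l) - (1 + r l + (r l)\<^sup>2 / 2))) at_top at_top"
  proof (rule filterlim_at_top_mono)
    show "eventually (\<lambda>l. l * r l ^ 3 / 6 \<le> l * (exp (r l) - (1 + r l + (r l)\<^sup>2 / 2))) at_top"
      using eventually_pos by eventually_elim (intro exp_log_excess_bounds(3); simp)
  qed
  then have lim: "filterlim (\<lambda>l. excess_exp l (r l)) at_top at_top"
    unfolding excess_exp_def by (rule filterlim_compose[OF exp_at_top])
  have "filterlim (\<lambda>l. 1/2 * excess_exp l (r l)) at_top at_top"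
    by (rule filterlim_tendsto_pos_mult_at_top[OF tendsto_const _ lim]) simp
  then show "filterlim (\<lambda>l. 1/2 * excess_exp l (sqrt (k l / l))) at_top at_top"
    by (simp add: r_def)
  have inv: "((\<lambda>l. inverse (excess_exp l (r l))) \<longlongrightarrow> 0) at_top"
    using lim by (rule tendsto_inverse_0_at_top)
  have "((\<lambda>l. (-1) ^ k l * excess_exp l (- r l) / excess_exp l (r l)) \<longlongrightarrow> 0) at_top"
  proof (rule Lim_null_comparison[OF _ inv])
    show "eventually (\<lambda>l. norm ((-1) ^ k l * excess_exp l (- r l) / excess_exp l (r l))
        \<le> inverse (excess_exp l (r l))) at_top"
      using eventually_pos
    proof eventually_elim
      case (elim l)
      have "excess_exp l (- r l) \<le> 1"
        using exp_log_excess_bounds(4)[of l "r l"] elim by (simp add: excess_exp_def)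
      moreover have "0 < excess_exp l x" for x by (simp add: excess_exp_def)
      ultimately show ?case
        by (simp add: abs_mult power_abs divide_inverse abs_of_pos mult_left_le_one_le)
    qed
  qed
  then have "((\<lambda>l. 1 + (-1) ^ k l * excess_exp l (- r l) / excess_exp l (r l)
      - 2 * ((parity_exp l (k l) - moment_ratio l (k l)) / excess_exp l (r l))) \<longlongrightarrow> 1 + 0 - 2 * 0) at_top"
    by (intro tendsto_intros error_tendsto_0)
  moreover have "1 + (-1) ^ k l * excess_exp l (- r l) / excess_exp l (r l)
      - 2 * ((parity_exp l (k l) - moment_ratio l (k l)) / excess_exp l (r l))
      = moment_ratio l (k l) / (1/2 * excess_exp l (r l))" for l
  proof -
    have "excess_exp l (r l) \<noteq> 0" by (simp add: excess_exp_def)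
    then show ?thesis by (simp add: parity_exp_def r_def field_simps)
  qed
  ultimately have "((\<lambda>l. moment_ratio l (k l) / (1/2 * excess_exp l (r l))) \<longlongrightarrow> 1) at_top"
    by simp
  then show "(\<lambda>l. moment_ratio l (k l)) \<sim>[at_top] (\<lambda>l. 1/2 * excess_exp l (sqrt (k l / l)))"
    unfolding r_def by (rule asymp_equivI')
qed

section \<open>Orders at the cube root\<close>

definition cubic_model :: "real \<Rightarrow> nat \<Rightarrow> real" where
  "cubic_model l k = 1/2 * exp (real k powr (3/2) / (6 * l powr (1/2)))
    * (1 + (-1) ^ k * exp (- (real k powr (3/2) / (3 * l powr (1/2)))))"

text \<open>Shows that the model is \<open>parity_exp\<close> with
  \<open>ln B(\<plusminus>r)\<close> replaced by its cubic term \<open>\<plusminus>x\<close>, hence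
  \<open>cosh x\<close> or \<open>sinh x\<close> according to parity.\<close>

lemma cubic_model_eq:
  assumes "0 < l" "1 \<le> k"
  defines "x \<equiv> l * sqrt (k / l) ^ 3 / 6"
  shows "cubic_model l k = (exp x + (-1) ^ k * exp (- x)) / 2"
proof -
  have "real k powr (3/2) = sqrt k ^ 3"
  proof -
    have "sqrt k ^ 3 = (real k powr (1/2)) ^ 3" by (simp add: powr_half_sqrt)
    also have "\<dots> = real k powr (3/2)"
      unfolding power3_eq_cube powr_add[symmetric] by simp
    finally show ?thesis by simp
  qed
  moreover have "l * sqrt (k / l) ^ 3 = sqrt k ^ 3 / sqrt l"
    using assms(1) by (simp add: real_sqrt_divide power_divide power3_eq_cube)
  ultimately have x: "real k powr (3/2) / (6 * l powr (1/2)) = x" "real k powr (3/2) / (3 * l powr (1/2)) = 2 * x"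
    using assms(1) by (simp_all add: x_def powr_half_sqrt)
  have "exp x * exp (- (2 * x)) = exp (- x)"
    by (simp flip: exp_add)
  then show ?thesis
    unfolding cubic_model_def x by (simp add: distrib_left mult.left_commute)
qed

text \<open>\<open>x = l r^3 / 6\<close> stays in a compact subset of the positive reals, so the
  model is bounded above and away from 0, even for odd \<open>k\<close>, where it is
  \<open>sinh x \<ge> x\<close>. An absolute error tending to 0 is therefore also a relative
  one.\<close>

lemma moment_at_cube_root:
  fixes k :: "real \<Rightarrow> nat"
  assumes order: "(\<lambda>l. real (k l)) \<in> \<Theta>[at_top](\<lambda>l. l powr (1/3))"
  shows "(\<lambda>l. moment_ratio l (k l)) \<sim>[at_top] (\<lambda>l. cubic_model l (k l))"
    and "(\<lambda>l. cubic_model l (k l)) \<in> \<Theta>[at_top](\<lambda>_. 1)"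
proof -
  obtain c where c: "0 < c" "eventually (\<lambda>l. norm (real (k l)) \<ge> c * norm (l powr (1/3))) at_top"
    using bigthetaD2[OF order] by (rule landau_omega.bigE)
  obtain d where d: "0 < d" "eventually (\<lambda>l. norm (real (k l)) \<le> d * norm (l powr (1/3))) at_top"
    using bigthetaD1[OF order] by (rule landau_o.bigE)
  have small: "(\<lambda>l. real (k l)) \<in> o[at_top](\<lambda>l. l powr (1/2))"
    by (rule landau_o.big_small_trans[OF bigthetaD1[OF order]]) real_asymp
  have k1: "eventually (\<lambda>l. 1 \<le> k l) at_top"
    using c(2) eventually_gt_at_top[of 0]
  proof eventually_elim
    case (elim l)
    then have "0 < c * norm (l powr (1/3))" using c(1) by simp
    then have "0 < norm (real (k l))" using elim(1) by (rule less_le_trans)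
    then show ?case by simp
  qed
  interpret small_order k
    using small k1 by unfold_locales
  define x where "x l = l * r l ^ 3 / 6" for l
  \<comment> \<open>These bounds for \<open>x\<close> are the images under
    \<open>order_cubed\<close> of the bounds \<open>c\<close> and \<open>d\<close> on
    \<open>k / l^(1/3)\<close>.\<close>
  define a where "a = sqrt c ^ 3 / 6"
  define b where "b = sqrt d ^ 3 / 6"
  have a: "0 < a" using c(1) by (simp add: a_def)
  have x: "eventually (\<lambda>l. a \<le> x l \<and> x l \<le> b) at_top"
    using c(2) d(2) eventually_gt_at_top[of 0]
  proof eventually_elim
    case (elim l)
    define u where "u = real (k l) / l powr (1/3)"
    have "c \<le> u" "u \<le> d"
      using elim by (auto simp: u_def pos_le_divide_eq pos_divide_le_eq)
    then have "sqrt c ^ 3 \<le> sqrt u ^ 3" "sqrt u ^ 3 \<le> sqrt d ^ 3"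
      using c(1) by (auto intro!: power_mono)
    moreover have "l * r l ^ 3 = sqrt u ^ 3"
      unfolding r_def u_def using elim(3) by (rule order_cubed)
    ultimately show ?case
      by (simp add: a_def b_def x_def)
  qed
  have Q: "eventually (\<lambda>l. cubic_model l (k l) = (exp (x l) + (-1) ^ k l * exp (- x l)) / 2) at_top"
    using eventually_pos by eventually_elim (simp add: cubic_model_eq x_def r_def)
  have Q_bounds: "eventually (\<lambda>l. a \<le> cubic_model l (k l) \<and> cubic_model l (k l) \<le> exp b) at_top"
    using Q x
  proof eventually_elim
    case (elim l)
    have x0: "0 \<le> x l" using elim(2) a by simp
    have "sinh (x l) \<le> cubic_model l (k l)" "cubic_model l (k l) \<le> cosh (x l)"
      unfolding elim(1) sinh_field_def cosh_field_def
      by (cases "even (k l)"; simp)+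
    moreover have "x l \<le> sinh (x l)" using x0 by (rule le_sinh)
    moreover have "cosh (x l) \<le> exp (x l)"
      unfolding cosh_field_def using x0 by simp
    moreover have "exp (x l) \<le> exp b" using elim(2) by simp
    ultimately show ?case using elim(2) by linarith
  qed
  show "(\<lambda>l. cubic_model l (k l)) \<in> \<Theta>[at_top](\<lambda>_. 1)"
    by (rule bigthetaI'[of a "exp b"])
      (use a Q_bounds in \<open>auto elim!: eventually_mono\<close>)
  define \<delta>1 where "\<delta>1 l = l * (exp (r l) - (1 + r l + (r l)\<^sup>2 / 2)) - x l" for l
  define \<delta>2 where "\<delta>2 l = l * (exp (- r l) - (1 + - r l + (- r l)\<^sup>2 / 2)) - - x l" for l
  have \<delta>1: "(\<delta>1 \<longlongrightarrow> 0) at_top"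
  proof (rule Lim_null_comparison[OF _ exp_r_l_r_pow_4_tendsto_0])
    show "eventually (\<lambda>l. norm (\<delta>1 l) \<le> exp (r l) * (l * r l ^ 4)) at_top"
      using eventually_pos unfolding \<delta>1_def x_def real_norm_def
      by eventually_elim (intro exp_log_excess_bounds(1); simp)
  qed
  have \<delta>2: "(\<delta>2 \<longlongrightarrow> 0) at_top"
  proof (rule Lim_null_comparison[OF _ exp_r_l_r_pow_4_tendsto_0])
    show "eventually (\<lambda>l. norm (\<delta>2 l) \<le> exp (r l) * (l * r l ^ 4)) at_top"
      using eventually_pos unfolding \<delta>2_def x_def real_norm_def
      by eventually_elim (intro exp_log_excess_bounds(2); simp)
  qed
  define \<epsilon> where "\<epsilon> l = (parity_exp l (k l) - moment_ratio l (k l)) / excess_exp l (r l)" for l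
  \<comment> \<open>The first two terms account for replacing the logarithms of \<open>B(r)\<close>
    and \<open>B(- r)\<close> by their cubic terms, the third for replacing the weights by
    1.\<close>
  define err where "err l = exp b * \<bar>exp (\<delta>1 l) - 1\<bar> + \<bar>exp (\<delta>2 l) - 1\<bar> + exp b * exp (\<delta>1 l) * \<bar>\<epsilon> l\<bar>" for l
  have "(err \<longlongrightarrow> exp b * \<bar>exp 0 - 1\<bar> + \<bar>exp 0 - 1\<bar> + exp b * exp 0 * \<bar>0\<bar>) at_top"
    unfolding err_def \<epsilon>_def by (intro tendsto_intros \<delta>1 \<delta>2 error_tendsto_0)
  then have err: "((\<lambda>l. err l / a) \<longlongrightarrow> 0) at_top"
    using tendsto_divide[OF _ tendsto_const, of err 0 at_top a] a by simp
  have "((\<lambda>l. moment_ratio l (k l) / cubic_model l (k l) - 1) \<longlongrightarrow> 0) at_top"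
  proof (rule Lim_null_comparison[OF _ err])
    show "eventually (\<lambda>l. norm (moment_ratio l (k l) / cubic_model l (k l) - 1) \<le> err l / a) at_top"
      using Q Q_bounds x
    proof eventually_elim
      case (elim l)
      have x0: "0 \<le> x l" "x l \<le> b" using elim(3) a by auto
      have B: "excess_exp l (r l) = exp (x l) * exp (\<delta>1 l)" "excess_exp l (- r l) = exp (- x l) * exp (\<delta>2 l)"
        unfolding excess_exp_def exp_add[symmetric] by (simp_all add: \<delta>1_def \<delta>2_def)
      have "moment_ratio l (k l) - cubic_model l (k l)
          = exp (x l) * (exp (\<delta>1 l) - 1) / 2 + (-1) ^ k l * exp (- x l) * (exp (\<delta>2 l) - 1) / 2
            - exp (x l) * exp (\<delta>1 l) * \<epsilon> l"
      proof -
        have "exp (x l) * exp (\<delta>1 l) * \<epsilon> l = parity_exp l (k l) - moment_ratio l (k l)"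
          unfolding \<epsilon>_def B by simp
        moreover have "parity_exp l (k l) = (exp (x l) * exp (\<delta>1 l) + (-1) ^ k l * (exp (- x l) * exp (\<delta>2 l))) / 2"
          unfolding parity_exp_def r_def[symmetric] B ..
        ultimately show ?thesis
          unfolding elim(1) by (simp add: field_simps)
      qed
      also have "\<bar>\<dots>\<bar> \<le> \<bar>exp (x l) * (exp (\<delta>1 l) - 1) / 2\<bar> + \<bar>(-1) ^ k l * exp (- x l) * (exp (\<delta>2 l) - 1) / 2\<bar>
            + \<bar>exp (x l) * exp (\<delta>1 l) * \<epsilon> l\<bar>"
        by linarith
      also have "\<dots> = exp (x l) * \<bar>exp (\<delta>1 l) - 1\<bar> / 2 + exp (- x l) * \<bar>exp (\<delta>2 l) - 1\<bar> / 2
            + exp (x l) * exp (\<delta>1 l) * \<bar>\<epsilon> l\<bar>"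
        by (simp add: abs_mult power_abs)
      also have "\<dots> \<le> err l"
      proof -
        have 1: "exp (x l) * \<bar>exp (\<delta>1 l) - 1\<bar> \<le> exp b * \<bar>exp (\<delta>1 l) - 1\<bar>"
          using x0 by (intro mult_right_mono) auto
        have 2: "exp (- x l) * \<bar>exp (\<delta>2 l) - 1\<bar> \<le> 1 * \<bar>exp (\<delta>2 l) - 1\<bar>"
          using x0 by (intro mult_right_mono) auto
        have 3: "exp (x l) * exp (\<delta>1 l) * \<bar>\<epsilon> l\<bar> \<le> exp b * exp (\<delta>1 l) * \<bar>\<epsilon> l\<bar>"
          using x0 by (intro mult_right_mono) auto
        have "y / 2 + z / 2 + w \<le> y' + z' + w'"
          if "0 \<le> y" "0 \<le> z" "y \<le> y'" "z \<le> 1 * z'" "w \<le> w'" for y z w y' z' w' :: real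
          using that by linarith
        from this[OF _ _ 1 2 3] show ?thesis
          unfolding err_def by simp
      qed
      finally have d: "\<bar>moment_ratio l (k l) - cubic_model l (k l)\<bar> \<le> err l" .
      have Q0: "0 < cubic_model l (k l)" using elim(2) a by linarith
      have "norm (moment_ratio l (k l) / cubic_model l (k l) - 1)
          = \<bar>moment_ratio l (k l) - cubic_model l (k l)\<bar> / cubic_model l (k l)"
        using Q0 by (simp add: field_simps abs_divide)
      also have "\<dots> \<le> err l / a"
        using d elim(2) a by (intro frac_le) auto
      finally show ?case .
    qed
  qed
  then have "((\<lambda>l. moment_ratio l (k l) / cubic_model l (k l)) \<longlongrightarrow> 1) at_top"
    by (rule LIM_zero_cancel)
  then show "(\<lambda>l. moment_ratio l (k l)) \<sim>[at_top] (\<lambda>l. cubic_model l (k l))"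
    by (rule asymp_equivI')
qed

theorem theorem1p3:
  shows
    "(\<forall>A>0. \<exists>C::real. \<forall>l>0. \<forall>k::nat. 1 \<le> k \<and> real k \<le> A * l powr (1/3) \<longrightarrow>
        (\<exists>\<theta>::real. \<bar>\<theta>\<bar> \<le> C * (real k ^ 3 / l) \<and>
           poisson_std_moment l k =
             (gauss_moment k + real k * (real k - 1) * gauss_moment (k - 1) / (6 * sqrt l)) * (1 + \<theta>)))
     \<and>
     (\<forall>k :: real \<Rightarrow> nat.
        (\<lambda>l. real (k l)) \<in> \<Theta>[at_top](\<lambda>l. l powr (1/3)) \<longrightarrow>
        (\<lambda>l. inverse (gauss_moment_Gamma (k l)) * poisson_std_moment l (k l)) \<sim>[at_top]
          (\<lambda>l. 1/2 * exp (real (k l) powr (3/2) / (6 * l powr (1/2)))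
                 * (1 + (-1) ^ k l * exp (- (real (k l) powr (3/2) / (3 * l powr (1/2)))))) \<and>
        (\<lambda>l. 1/2 * exp (real (k l) powr (3/2) / (6 * l powr (1/2)))
                 * (1 + (-1) ^ k l * exp (- (real (k l) powr (3/2) / (3 * l powr (1/2))))))
          \<in> \<Theta>[at_top](\<lambda>_. 1))
     \<and>
     (\<forall>k :: real \<Rightarrow> nat.
        filterlim (\<lambda>l. real (k l) / l powr (1/3)) at_top at_top \<and>
        (\<lambda>l. real (k l)) \<in> o[at_top](\<lambda>l. l powr (1/2)) \<longrightarrow>
        (let r = (\<lambda>l. sqrt (real (k l) / l)) in
          (\<lambda>l. inverse (gauss_moment_Gamma (k l)) * poisson_std_moment l (k l)) \<sim>[at_top]
            (\<lambda>l. 1/2 * exp (l * (exp (r l) - (1 + r l + (r l)\<^sup>2 / 2)))) \<and>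
          filterlim (\<lambda>l. 1/2 * exp (l * (exp (r l) - (1 + r l + (r l)\<^sup>2 / 2)))) at_top at_top))"
proof (intro conjI allI impI, goal_cases)
  case (1 A)
  then show ?case by (rule moment_below_cube_root[unfolded main_term_def])
next
  case (2 k)
  then show ?case by (rule moment_at_cube_root(1)[unfolded moment_ratio_def cubic_model_def])
next
  case (3 k)
  then show ?case by (rule moment_at_cube_root(2)[unfolded cubic_model_def])
next
  case (4 k)
  then show ?case
    using moment_above_cube_root[of k] unfolding moment_ratio_def excess_exp_def Let_def by blast
qed

end
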